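(* For the two-user IM/DD interference channel with all channel gains positive, the capacity region satisfies $\mathcal{G}\subseteq\mathcal{G}'_{\rm ge}$, where $\mathcal{G}'_{\rm ge}$ is the set of all $(\mathsf{R}_1,\mathsf{R}_2)\in\mathbb{R}_+^2$ such that $$\mathsf{R}_i\le\overline{\mathsf{C}}(h_{ii}\mathsf{A},\alpha_i),\quad i\in\{1,2\},$$ $$\mathsf{R}_1+\mathsf{R}_2\le\sum_{\substack{i,j\in\{1,2\}\\ i\neq j}}\Big[\overline{\mathsf{C}}\Big(\frac{h_{12}h_{21}}{\sqrt{h_{ii}^2+h_{ij}^2}}\mathsf{A},\alpha_j\Big)+\frac12\log\Big(1+\frac{h_{ii}^2}{h_{ij}^2}\Big)\Big].$$
   Context: Two-user IM/DD interference channel: for $i,j\in\{1,2\}$, $i\neq j$, $Y_i=h_{ii}X_i+h_{ji}X_j+Z_i$, with channel gains $h_{kl}>0$, noises $Z_1,Z_2\sim\mathcal{N}(0,\sigma^2)$ ($\sigma>0$) i.i.d. over time and independent of inputs; inputs satisfy $X_i\in[0,\mathsf{A}]$ ($\mathsf{A}>0$) and $\mathbb{E}[X_i]\le\alpha_i\mathsf{A}$, $\alpha_i\in(0,1]$. Transmitter $i$ encodes $m_i\in\{1,\dots,\lceil2^{n\mathsf{R}_i}\rceil\}$ into a length-$n$ codeword satisfying these constraints; receiver $i$ decodes $m_i$ from $Y_i^n$; $(\mathsf{R}_1,\mathsf{R}_2)$ is achievable if both average error probabilities tend to $0$; $\mathcal{G}$ is the closure of achievable pairs. Logs base 2, $\mathcal{Q}(x)=\int_x^\infty\frac{1}{\sqrt{2\pi}}e^{-t^2/2}dt$.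 $\overline{\mathsf{C}}(\mathsf{A},\alpha)=c_1$ if $\alpha\in(0,\frac12)$, $=c_2$ if $\alpha\in[\frac12,1]$, where $$c_1=\min_{\mu,\xi>0}\Big[1-\mathcal{Q}\big(\tfrac{\xi+\alpha\mathsf{A}}{\sigma}\big)-\mathcal{Q}\big(\tfrac{\xi+(1-\alpha)\mathsf{A}}{\sigma}\big)\Big]\log\Big(\frac{\mathsf{A}}{\sigma}\frac{e^{\mu\xi/\mathsf{A}}-e^{-\mu(1+\xi/\mathsf{A})}}{\sqrt{2\pi}\mu(1-2\mathcal{Q}(\xi/\sigma))}\Big)+\log(e)\Big[-\tfrac12+\mathcal{Q}\big(\tfrac{\xi}{\sigma}\big)+\tfrac{\xi}{\sqrt{2\pi}\sigma}e^{-\frac{\xi^2}{2\sigma^2}}+\tfrac{\sigma}{\mathsf{A}}\tfrac{\mu}{\sqrt{2\pi}}\big(e^{-\frac{\xi^2}{2\sigma^2}}-e^{-\frac{(\mathsf{A}+\xi)^2}{2\sigma^2}}\big)+\mu\alpha\big(1-2\mathcal{Q}\big(\tfrac{\xi+\mathsf{A}/2}{\sigma}\big)\big)\Big],$$ $$c_2=\min_{\xi>0}\Big[1-2\mathcal{Q}\big(\tfrac{\xi+\mathsf{A}/2}{\sigma}\big)\Big]\log\Big(\frac{\mathsf{A}+2\xi}{\sigma\sqrt{2\pi}(1-2\mathcal{Q}(\xi/\sigma))}\Big)+\log(e)\Big[-\tfrac12+\mathcal{Q}\big(\tfrac{\xi}{\sigma}\big)+\tfrac{\xi}{\sqrt{2\pi}\sigma}e^{-\frac{\xi^2}{2\sigma^2}}\Big].$$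 (It is an upper bound on $\sup\mathsf{I}(X;X+Z)$ over $X\in[0,\mathsf{A}]$ with $\mathbb{E}[X]\le\alpha\mathsf{A}$, $Z\sim\mathcal{N}(0,\sigma^2)$.) *)

theory Defs
  imports "HOL-Probability.Probability"
begin

definition Qfun :: "real \<Rightarrow> real" where
  "Qfun x = (LINT t:{x<..}|lborel. std_normal_density t)"

text \<open>First branch c1 (alpha in (0,1/2)); the paper's min over mu, xi > 0 is rendered as an infimum.\<close>
definition Cbar1 :: "real \<Rightarrow> real \<Rightarrow> real \<Rightarrow> real" where
  "Cbar1 \<sigma> A \<alpha> = (INF p \<in> {p :: real \<times> real. fst p > 0 \<and> snd p > 0}.
     (let \<mu> = fst p; \<xi> = snd p in
       (1 - Qfun ((\<xi> + \<alpha> * A) / \<sigma>) - Qfun ((\<xi> + (1 - \<alpha>) * A) / \<sigma>))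
         * log 2 ((A / \<sigma>) * (exp (\<mu> * \<xi> / A) - exp (- \<mu> * (1 + \<xi> / A)))
                  / (sqrt (2 * pi) * \<mu> * (1 - 2 * Qfun (\<xi> / \<sigma>))))
       + log 2 (exp 1) *
         (- 1 / 2 + Qfun (\<xi> / \<sigma>)
          + \<xi> / (sqrt (2 * pi) * \<sigma>) * exp (- \<xi>\<^sup>2 / (2 * \<sigma>\<^sup>2))
          + (\<sigma> / A) * (\<mu> / sqrt (2 * pi))
              * (exp (- \<xi>\<^sup>2 / (2 * \<sigma>\<^sup>2)) - exp (- (A + \<xi>)\<^sup>2 / (2 * \<sigma>\<^sup>2)))
          + \<mu> * \<alpha> * (1 - 2 * Qfun ((\<xi> + A / 2) / \<sigma>)))))"

text \<open>Second branch c2 (alpha in [1/2,1]); min over xi > 0 rendered as an infimum.\<close>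
definition Cbar2 :: "real \<Rightarrow> real \<Rightarrow> real" where
  "Cbar2 \<sigma> A = (INF \<xi> \<in> {0<..}.
       (1 - 2 * Qfun ((\<xi> + A / 2) / \<sigma>))
         * log 2 ((A + 2 * \<xi>) / (\<sigma> * sqrt (2 * pi) * (1 - 2 * Qfun (\<xi> / \<sigma>))))
       + log 2 (exp 1) *
         (- 1 / 2 + Qfun (\<xi> / \<sigma>)
          + \<xi> / (sqrt (2 * pi) * \<sigma>) * exp (- \<xi>\<^sup>2 / (2 * \<sigma>\<^sup>2))))"

definition Cbar :: "real \<Rightarrow> real \<Rightarrow> real \<Rightarrow> real" where
  "Cbar \<sigma> A \<alpha> = (if \<alpha> < 1 / 2 then Cbar1 \<sigma> A \<alpha> else Cbar2 \<sigma> A)"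

definition valid_codeword :: "real \<Rightarrow> real \<Rightarrow> nat \<Rightarrow> (nat \<Rightarrow> real) \<Rightarrow> bool" where
  "valid_codeword A \<alpha> n x \<longleftrightarrow>
     (\<forall>t<n. 0 \<le> x t \<and> x t \<le> A) \<and> (\<Sum>t<n. x t) \<le> real n * (\<alpha> * A)"

definition out_dist :: "real \<Rightarrow> nat \<Rightarrow> (nat \<Rightarrow> real) \<Rightarrow> (nat \<Rightarrow> real) measure" where
  "out_dist \<sigma> n \<mu> = PiM {..<n} (\<lambda>t. density lborel (normal_density (\<mu> t) \<sigma>))"

definition is_code ::
  "real \<Rightarrow> real \<Rightarrow> real \<Rightarrow> nat \<Rightarrow> nat \<Rightarrow> nat \<Rightarrow>
   (nat \<Rightarrow> nat \<Rightarrow> real) \<Rightarrow> (nat \<Rightarrow> nat \<Rightarrow> real) \<Rightarrow>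
   ((nat \<Rightarrow> real) \<Rightarrow> nat) \<Rightarrow> ((nat \<Rightarrow> real) \<Rightarrow> nat) \<Rightarrow> bool" where
  "is_code A \<alpha>1 \<alpha>2 n M1 M2 f1 f2 g1 g2 \<longleftrightarrow>
     (\<forall>m\<in>{1..M1}. valid_codeword A \<alpha>1 n (f1 m)) \<and>
     (\<forall>m\<in>{1..M2}. valid_codeword A \<alpha>2 n (f2 m)) \<and>
     g1 \<in> PiM {..<n} (\<lambda>_. borel) \<rightarrow>\<^sub>M count_space UNIV \<and>
     g2 \<in> PiM {..<n} (\<lambda>_. borel) \<rightarrow>\<^sub>M count_space UNIV"

definition err1 ::
  "real \<Rightarrow> real \<Rightarrow> real \<Rightarrow> nat \<Rightarrow> nat \<Rightarrow> nat \<Rightarrow>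
   (nat \<Rightarrow> nat \<Rightarrow> real) \<Rightarrow> (nat \<Rightarrow> nat \<Rightarrow> real) \<Rightarrow> ((nat \<Rightarrow> real) \<Rightarrow> nat) \<Rightarrow> real" where
  "err1 \<sigma> h11 h21 n M1 M2 f1 f2 g1 =
     (1 / (real M1 * real M2)) *
     (\<Sum>m1\<in>{1..M1}. \<Sum>m2\<in>{1..M2}.
        (let P = out_dist \<sigma> n (\<lambda>t. h11 * f1 m1 t + h21 * f2 m2 t)
         in measure P {y \<in> space P. g1 y \<noteq> m1}))"

definition err2 ::
  "real \<Rightarrow> real \<Rightarrow> real \<Rightarrow> nat \<Rightarrow> nat \<Rightarrow> nat \<Rightarrow>
   (nat \<Rightarrow> nat \<Rightarrow> real) \<Rightarrow> (nat \<Rightarrow> nat \<Rightarrow> real) \<Rightarrow> ((nat \<Rightarrow> real) \<Rightarrow> nat) \<Rightarrow> real" where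
  "err2 \<sigma> h22 h12 n M1 M2 f1 f2 g2 =
     (1 / (real M1 * real M2)) *
     (\<Sum>m1\<in>{1..M1}. \<Sum>m2\<in>{1..M2}.
        (let P = out_dist \<sigma> n (\<lambda>t. h22 * f2 m2 t + h12 * f1 m1 t)
         in measure P {y \<in> space P. g2 y \<noteq> m2}))"

definition num_msgs :: "nat \<Rightarrow> real \<Rightarrow> nat" where
  "num_msgs n R = nat \<lceil>2 powr (real n * R)\<rceil>"

definition achievable ::
  "real \<Rightarrow> real \<Rightarrow> real \<Rightarrow> real \<Rightarrow> real \<Rightarrow> real \<Rightarrow> real \<Rightarrow> real \<Rightarrow> real \<times> real \<Rightarrow> bool" where
  "achievable \<sigma> A \<alpha>1 \<alpha>2 h11 h12 h21 h22 R \<longleftrightarrow>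
     0 \<le> fst R \<and> 0 \<le> snd R \<and>
     (\<exists>F1 F2 G1 G2.
        (\<forall>n. is_code A \<alpha>1 \<alpha>2 n (num_msgs n (fst R)) (num_msgs n (snd R))
                       (F1 n) (F2 n) (G1 n) (G2 n)) \<and>
        (\<lambda>n. err1 \<sigma> h11 h21 n (num_msgs n (fst R)) (num_msgs n (snd R)) (F1 n) (F2 n) (G1 n))
           \<longlonglongrightarrow> 0 \<and>
        (\<lambda>n. err2 \<sigma> h22 h12 n (num_msgs n (fst R)) (num_msgs n (snd R)) (F1 n) (F2 n) (G2 n))
           \<longlonglongrightarrow> 0)"

definition capacity_region ::
  "real \<Rightarrow> real \<Rightarrow> real \<Rightarrow> real \<Rightarrow> real \<Rightarrow> real \<Rightarrow> real \<Rightarrow> real \<Rightarrow> (real \<times> real) set" where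
  "capacity_region \<sigma> A \<alpha>1 \<alpha>2 h11 h12 h21 h22 =
     closure {R. achievable \<sigma> A \<alpha>1 \<alpha>2 h11 h12 h21 h22 R}"

definition outer_bound_ge ::
  "real \<Rightarrow> real \<Rightarrow> real \<Rightarrow> real \<Rightarrow> real \<Rightarrow> real \<Rightarrow> real \<Rightarrow> real \<Rightarrow> (real \<times> real) set" where
  "outer_bound_ge \<sigma> A \<alpha>1 \<alpha>2 h11 h12 h21 h22 =
     {(R1, R2). 0 \<le> R1 \<and> 0 \<le> R2 \<and>
        R1 \<le> Cbar \<sigma> (h11 * A) \<alpha>1 \<and>
        R2 \<le> Cbar \<sigma> (h22 * A) \<alpha>2 \<and>
        R1 + R2 \<le>
          (Cbar \<sigma> (h12 * h21 / sqrt (h11\<^sup>2 + h12\<^sup>2) * A) \<alpha>2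
             + 1 / 2 * log 2 (1 + h11\<^sup>2 / h12\<^sup>2))
          + (Cbar \<sigma> (h12 * h21 / sqrt (h22\<^sup>2 + h21\<^sup>2) * A) \<alpha>1
             + 1 / 2 * log 2 (1 + h22\<^sup>2 / h21\<^sup>2))}"

end

theory Submission
  imports Defs "HOL-Real_Asymp.Real_Asymp"
begin

text \<open>
  For any reference density q, a code with M messages and average error e over channels with
  densities p_m satisfies (1 - e) ln M - 1 \<le> avg_m D(p_m, q). With the interfering codeword fixed and
  q a product of shifted copies of a Gaussian-tailed exponential or uniform density, the relative
  entropy splits into single letters, each bounded by an expression concave in the input; Jensen's
  inequality (a tangent line) gives the single-user bounds.

  For the sum rate, receiver i is given S_i = h_ij X_i + Z_j. The law of Y_i given X_i is the law of
  S_j shifted by h_ii X_i, and q is the law of S_i times a product density in Y_i - (h_ii / h_ij) S_i.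
  In the sum of the two bounds the entropies of S_1 and S_2 cancel, and what remains is the
  peak-limited channel h_ji X_j plus noise of variance sigma^2 (1 + h_ii^2 / h_ij^2).
\<close>

section \<open>Gaussian integrals and the Q-function\<close>

text \<open>The noise is unbounded, so a reference density carried by [0, A] alone would give
  infinite relative entropy. Gaussian tails centred at the two ends of the interval, cut at distance
  \<xi>, keep the logarithm quadratic. For the sum rate, the n-letter entropies of S_1 and S_2
  cannot be evaluated for an arbitrary code and have to cancel exactly, so the genie bound keeps the
  true mixture laws of Y_i and S_i and estimates only the residual. Error probabilities involve each
  receiver's law separately, so the noise of S_i may be taken independent of the noise of Y_i. The
  residual is h_ji X_j + Z_i - (h_ii / h_ij) Z_j, free of X_i. Scaling it by k = h_ij / sqrt (h_ii^2
  + h_ij^2) restores the variance \<sigma>^2; the peak h_ji A becomes the amplitude in the sum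
  bound, and - log k is the half logarithm next to it. The average constraint binds each codeword,
  not each letter, so the single-letter estimate is summed over the whole codebook before it is
  used. Since the minima are rendered as infima, an arbitrarily small slack is carried until the
  end.\<close>

lemma set_integrable_const:
  fixes c :: real
  assumes "S \<in> sets M" "emeasure M S < \<infinity>"
  shows "set_integrable M S (\<lambda>_. c)"
  unfolding set_integrable_def using assms
  by (intro integrable_scaleR_left) (simp add: integrable_real_indicator)

section \<open>Tail masses and truncated moments of the normal density\<close>

lemma normal_density_scale:
  assumes "\<sigma> > 0"
  shows "\<sigma> * normal_density m \<sigma> (m + \<sigma> * t) = std_normal_density t"
    and "\<sigma> * normal_density m \<sigma> (m - \<sigma> * t) = std_normal_density t"
  using assms by (simp_all add: normal_density_def real_sqrt_mult power_mult_distrib)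

text \<open>Substitution y = m + \<sigma> t. The factor f is carried along in standardised form, so
  that tail masses (f = 1) and tail second moments (f = t^2 / 2) come from the same
  computation.\<close>

lemma normal_right_tail_std:
  assumes "\<sigma> > 0"
  shows "(LINT y:{a<..}|lborel. normal_density m \<sigma> y * f ((y - m) / \<sigma>))
       = (LINT t:{(a - m) / \<sigma><..}|lborel. std_normal_density t * f t)"
proof -
  have "(LINT y:{a<..}|lborel. normal_density m \<sigma> y * f ((y - m) / \<sigma>)) =
      \<bar>\<sigma>\<bar> *\<^sub>R (\<integral>t. indicator {a<..} (m + \<sigma> * t) *\<^sub>R
        (normal_density m \<sigma> (m + \<sigma> * t) * f ((m + \<sigma> * t - m) / \<sigma>)) \<partial>lborel)"
    unfolding set_lebesgue_integral_def by (rule lborel_integral_real_affine) (use assms in simp)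
  also have "\<dots> = (\<integral>t. \<sigma> * (indicator {a<..} (m + \<sigma> * t) *
        (normal_density m \<sigma> (m + \<sigma> * t) * f t)) \<partial>lborel)"
    using assms by simp
  also have "\<dots> = (LINT t:{(a - m) / \<sigma><..}|lborel. std_normal_density t * f t)"
    unfolding set_lebesgue_integral_def normal_density_scale(1)[OF assms, of m, symmetric]
    using assms by (intro Bochner_Integration.integral_cong)
      (auto simp: indicator_def field_simps)
  finally show ?thesis .
qed

text \<open>The reflected substitution y = m - \<sigma> t turns left tails into right tails of the
  standard density, the form in which \<open>Qfun\<close> is defined.\<close>

lemma normal_left_tail_std:
  assumes "\<sigma> > 0"
  shows "(LINT y:{..<a}|lborel. normal_density m \<sigma> y * f ((m - y) / \<sigma>))
       = (LINT t:{(m - a) / \<sigma><..}|lborel. std_normal_density t * f t)"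
proof -
  have "(LINT y:{..<a}|lborel. normal_density m \<sigma> y * f ((m - y) / \<sigma>)) =
      \<bar>-\<sigma>\<bar> *\<^sub>R (\<integral>t. indicator {..<a} (m + (-\<sigma>) * t) *\<^sub>R
        (normal_density m \<sigma> (m + (-\<sigma>) * t) * f ((m - (m + (-\<sigma>) * t)) / \<sigma>)) \<partial>lborel)"
    unfolding set_lebesgue_integral_def by (rule lborel_integral_real_affine) (use assms in simp)
  also have "\<dots> = (\<integral>t. \<sigma> * (indicator {..<a} (m - \<sigma> * t) *
        (normal_density m \<sigma> (m - \<sigma> * t) * f t)) \<partial>lborel)"
    using assms by simp
  also have "\<dots> = (LINT t:{(m - a) / \<sigma><..}|lborel. std_normal_density t * f t)"
    unfolding set_lebesgue_integral_def normal_density_scale(2)[OF assms, of m, symmetric]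
    using assms by (intro Bochner_Integration.integral_cong)
      (auto simp: indicator_def field_simps)
  finally show ?thesis .
qed

lemma normal_right_tail:
  assumes "\<sigma> > 0"
  shows "(LINT y:{a<..}|lborel. normal_density m \<sigma> y) = Qfun ((a - m) / \<sigma>)"
  using normal_right_tail_std[OF assms, of a m "\<lambda>_. 1"] by (simp add: Qfun_def)

lemma normal_left_tail:
  assumes "\<sigma> > 0"
  shows "(LINT y:{..<a}|lborel. normal_density m \<sigma> y) = Qfun ((m - a) / \<sigma>)"
  using normal_left_tail_std[OF assms, of a m "\<lambda>_. 1"] by (simp add: Qfun_def)

lemma integrable_normal_quadratic:
  assumes "\<sigma> > 0"
  shows "integrable lborel (\<lambda>y. normal_density m \<sigma> y * (a + b * y + c * y\<^sup>2))"
proof -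
  \<comment> \<open>Taylor expansion of the polynomial at y = m, which brings it to centred
    moments.\<close>
  have "integrable lborel (\<lambda>y. (a + b * m + c * m\<^sup>2) * (normal_density m \<sigma> y * (y - m) ^ 0)
      + (b + 2 * c * m) * (normal_density m \<sigma> y * (y - m) ^ 1)
      + c * (normal_density m \<sigma> y * (y - m) ^ 2))"
    by (intro Bochner_Integration.integrable_add integrable_mult_right
        integrable_normal_moment[OF assms])
  then show ?thesis
    by (rule back_subst[where P="integrable lborel"])
       (auto simp: fun_eq_iff algebra_simps power2_eq_square)
qed

lemma set_integrable_normal_quadratic:
  assumes "\<sigma> > 0" and [measurable]: "S \<in> sets borel"
  shows "set_integrable lborel S (\<lambda>y. normal_density m \<sigma> y * (a + b * y + c * y\<^sup>2))"
  unfolding set_integrable_def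
  by (rule integrable_mult_indicator) (use integrable_normal_quadratic[OF assms(1)] in auto)

lemma set_integrable_normal_density:
  assumes "\<sigma> > 0" and "S \<in> sets borel"
  shows "set_integrable lborel S (normal_density m \<sigma>)"
  using set_integrable_normal_quadratic[OF assms, of m 1 0 0] by simp

text \<open>The relevant cuts are a = - \<xi> and b = A + \<xi>, where \<open>peak_density\<close>
  changes its formula.\<close>

lemma normal_three_pieces:
  fixes f :: "real \<Rightarrow> real"
  assumes "integrable lborel f" and "a \<le> b"
  shows "(\<integral>y. f y \<partial>lborel) = (LINT y:{..<a}|lborel. f y) + (LINT y:{a..b}|lborel. f y)
      + (LINT y:{b<..}|lborel. f y)"
proof -
  have i: "integrable lborel (\<lambda>y. indicator S y *\<^sub>R f y)" if "S \<in> sets borel" for S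
    by (rule integrable_mult_indicator) (use assms that in auto)
  have "(\<integral>y. f y \<partial>lborel) = (\<integral>y. indicator {..<a} y *\<^sub>R f y + indicator {a..b} y *\<^sub>R f y
      + indicator {b<..} y *\<^sub>R f y \<partial>lborel)"
    by (rule Bochner_Integration.integral_cong) (use assms(2) in \<open>auto split: split_indicator\<close>)
  then show ?thesis
    unfolding set_lebesgue_integral_def
    by (simp add: i Bochner_Integration.integral_add Bochner_Integration.integrable_add
        del: real_scaleR_def)
qed

lemma normal_middle:
  assumes "\<sigma> > 0" and "a \<le> b"
  shows "(LINT y:{a..b}|lborel. normal_density m \<sigma> y)
      = 1 - Qfun ((m - a) / \<sigma>) - Qfun ((b - m) / \<sigma>)"
  using normal_three_pieces[OF integrable_normal_density[OF assms(1)] assms(2), of m]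
    integral_normal_density[OF assms(1), of m]
  by (simp add: normal_right_tail[OF assms(1)] normal_left_tail[OF assms(1)])

lemma normal_density_has_derivative:
  assumes "\<sigma> > 0"
  shows "((\<lambda>y. - \<sigma>\<^sup>2 * normal_density m \<sigma> y) has_real_derivative
      (y - m) * normal_density m \<sigma> y) (at y)"
proof -
  have "((\<lambda>y. - (y - m)\<^sup>2 / (2 * \<sigma>\<^sup>2)) has_real_derivative - (y - m) / \<sigma>\<^sup>2) (at y)"
    using assms by (auto intro!: derivative_eq_intros simp: field_simps)
  from DERIV_cmult[OF DERIV_fun_exp[OF this], of "- \<sigma>\<^sup>2 * (1 / sqrt (2 * pi * \<sigma>\<^sup>2))"]
  show ?thesis
    unfolding normal_density_def
    unfolding mult.assoc by (rule DERIV_cong) (use assms in \<open>simp add: divide_simps algebra_simps\<close>)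
qed

lemma normal_middle_moment:
  assumes "\<sigma> > 0" and "a \<le> b"
  shows "(LINT y:{a..b}|lborel. normal_density m \<sigma> y * (y - m))
      = \<sigma>\<^sup>2 * (normal_density m \<sigma> a - normal_density m \<sigma> b)"
proof -
  have "(\<integral>y. (y - m) * normal_density m \<sigma> y * indicator {a..b} y \<partial>lborel)
     = - \<sigma>\<^sup>2 * normal_density m \<sigma> b - (- \<sigma>\<^sup>2 * normal_density m \<sigma> a)"
  proof (rule integral_FTC_Icc_real[OF assms(2)])
    show "isCont (\<lambda>y. (y - m) * normal_density m \<sigma> y) y" for y
      unfolding normal_density_def by (intro continuous_intros) (use assms in auto)
  qed (rule normal_density_has_derivative[OF assms(1)])
  then show ?thesis
    by (simp add: set_lebesgue_integral_def algebra_simps)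
qed

text \<open>With \<phi> the standard normal density, - t \<phi>(t) is an antiderivative of (t^2 - 1)
  \<phi>(t); the - 1 accounts for the term \<open>Qfun x\<close>.\<close>

lemma std_normal_tail_second_moment:
  "(LINT t:{x<..}|lborel. std_normal_density t * t\<^sup>2) = Qfun x + x * std_normal_density x"
proof -
  let ?F = "\<lambda>t. - t * std_normal_density t"
  let ?f = "\<lambda>t. std_normal_density t * (t\<^sup>2 - 1)"
  have int: "set_integrable lborel {x<..} (\<lambda>t. std_normal_density t * t\<^sup>2)"
    "set_integrable lborel {x<..} std_normal_density"
    using set_integrable_normal_quadratic[of 1 "{x<..}" 0 0 0 1]
      set_integrable_normal_density[of 1 "{x<..}" 0] by auto
  have "(LBINT t=ereal x..\<infinity>. ?f t) = 0 - ?F x"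
  proof (rule interval_integral_FTC_integrable)
    show "(?F has_vector_derivative ?f t) (at t)" for t
      unfolding has_real_derivative_iff_has_vector_derivative[symmetric] std_normal_density_def
      by (rule derivative_eq_intros refl | simp)+ (simp add: field_simps power2_eq_square)
    show "isCont ?f t" for t
      unfolding std_normal_density_def by (intro continuous_intros) auto
    have "set_integrable lborel {x<..} (\<lambda>t. std_normal_density t * t\<^sup>2 - std_normal_density t)"
      by (rule set_integral_diff(1)[OF int])
    moreover have "einterval (ereal x) \<infinity> = {x<..}" by (auto simp: einterval_def)
    ultimately show "set_integrable lborel (einterval (ereal x) \<infinity>) ?f"
      by (simp only: right_diff_distrib mult_1_right)
    have "(?F \<longlongrightarrow> ?F x) (at_right x)"
      unfolding std_normal_density_def by (intro tendsto_intros) auto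
    then show "((?F \<circ> real_of_ereal) \<longlongrightarrow> ?F x) (at_right (ereal x))"
      by (simp add: ereal_tendsto_simps)
    have "(?F \<longlongrightarrow> 0) at_top"
      unfolding std_normal_density_def by real_asymp
    then show "((?F \<circ> real_of_ereal) \<longlongrightarrow> 0) (at_left \<infinity>)"
      by (simp add: ereal_tendsto_simps)
  qed auto
  then have "(LINT t:{x<..}|lborel. ?f t) = x * std_normal_density x"
    by (simp add: interval_integral_to_infinity_eq)
  moreover have "(LINT t:{x<..}|lborel. ?f t)
      = (LINT t:{x<..}|lborel. std_normal_density t * t\<^sup>2) - Qfun x"
    unfolding Qfun_def by (subst set_integral_diff(2)[symmetric, OF int]) (simp add: right_diff_distrib)
  ultimately show ?thesis by simp
qed

section \<open>Convexity of the Q-function on the nonnegative half-line\<close>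

lemma Qfun_diff:
  assumes "u \<le> v"
  shows "Qfun u - Qfun v = (LINT t:{u<..v}|lborel. std_normal_density t)"
proof -
  have "{u<..} = {u<..v} \<union> {v<..}" using assms by auto
  moreover have "(LINT t:{u<..v} \<union> {v<..}|lborel. std_normal_density t)
      = (LINT t:{u<..v}|lborel. std_normal_density t) + (LINT t:{v<..}|lborel. std_normal_density t)"
    by (intro set_integral_Un set_integrable_normal_density) auto
  ultimately show ?thesis by (simp add: Qfun_def)
qed

lemma std_normal_density_antimono:
  assumes "0 \<le> s" "s \<le> t"
  shows "std_normal_density t \<le> std_normal_density s"
  using assms unfolding std_normal_density_def
  by (auto intro!: mult_left_mono divide_right_mono power_mono simp: divide_right_mono)

text \<open>The slope of Q at u is minus the density there, and the density decreases on the
  nonnegative half-line, so Q is convex on it. For either sign of v - u, the density between u and v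
  is compared with its value at u. The tangent form is the one that can be summed over many
  inputs.\<close>

lemma Qfun_above_tangent:
  assumes "0 \<le> u" "0 \<le> v"
  shows "Qfun v \<ge> Qfun u - (v - u) * std_normal_density u"
proof (cases "u \<le> v")
  case True
  have "set_integrable lborel {u<..v} (\<lambda>t. std_normal_density u)"
    using True by (intro set_integrable_const) auto
  then have "(LINT t:{u<..v}|lborel. std_normal_density t) \<le> (LINT t:{u<..v}|lborel. std_normal_density u)"
    using assms True
    by (intro set_integral_mono set_integrable_normal_density)
       (auto intro!: std_normal_density_antimono)
  then show ?thesis
    using Qfun_diff[OF True] True by (simp add: set_lebesgue_integral_def algebra_simps)
next
  case False
  then have "v \<le> u" by simp
  have "set_integrable lborel {v<..u} (\<lambda>t. std_normal_density u)"
    using \<open>v \<le> u\<close> by (intro set_integrable_const) auto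
  then have "(LINT t:{v<..u}|lborel. std_normal_density t) \<ge> (LINT t:{v<..u}|lborel. std_normal_density u)"
    using assms
    by (intro set_integral_mono set_integrable_normal_density)
       (auto intro!: std_normal_density_antimono)
  then show ?thesis
    using Qfun_diff[OF \<open>v \<le> u\<close>] \<open>v \<le> u\<close> by (simp add: set_lebesgue_integral_def algebra_simps)
qed

lemma set_integrable_normal_square:
  assumes "\<sigma> > 0" and "S \<in> sets borel"
  shows "set_integrable lborel S (\<lambda>y. normal_density m \<sigma> y * ((y - c)\<^sup>2 / (2 * \<sigma>\<^sup>2)))"
proof -
  have "(y - c)\<^sup>2 / (2 * \<sigma>\<^sup>2)
    = c\<^sup>2 / (2 * \<sigma>\<^sup>2) + (- 2 * c / (2 * \<sigma>\<^sup>2)) * y + 1 / (2 * \<sigma>\<^sup>2) * y\<^sup>2" for y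
    using assms(1) by (simp add: divide_simps power2_eq_square algebra_simps)
  then show ?thesis
    using set_integrable_normal_quadratic[OF assms, of m "c\<^sup>2 / (2 * \<sigma>\<^sup>2)"
        "- 2 * c / (2 * \<sigma>\<^sup>2)" "1 / (2 * \<sigma>\<^sup>2)"] by simp
qed

text \<open>A Gaussian weight absorbs quadratic growth of the logarithm. This is why
  \<open>output_kernel\<close> asks for a quadratic bound on ln R.\<close>

lemma integrable_normal_ln:
  assumes "\<sigma> > 0" and [measurable]: "f \<in> borel_measurable borel"
    and "\<And>y. \<bar>ln (f y)\<bar> \<le> a + b * y\<^sup>2"
  shows "integrable lborel (\<lambda>y. normal_density m \<sigma> y * ln (f y :: real))"
proof (rule Bochner_Integration.integrable_bound)
  show "integrable lborel (\<lambda>y. normal_density m \<sigma> y * (a + 0 * y + b * y\<^sup>2))"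
    by (rule integrable_normal_quadratic[OF assms(1)])
  show "AE y in lborel. norm (normal_density m \<sigma> y * ln (f y))
      \<le> norm (normal_density m \<sigma> y * (a + 0 * y + b * y\<^sup>2))"
    using assms(3) by (auto simp: abs_mult intro!: AE_I2 mult_left_mono order_trans[OF assms(3) abs_ge_self])
qed measurable

section \<open>The output density for a peak-limited input\<close>

text \<open>With l = mu / A this density yields the terms of c1, with l = 0 those of c2.\<close>

definition peak_density :: "real \<Rightarrow> real \<Rightarrow> real \<Rightarrow> real \<Rightarrow> real \<Rightarrow> real \<Rightarrow> real" where
  "peak_density \<sigma> A \<xi> \<kappa> l y =
    (if y < - \<xi> then normal_density 0 \<sigma> y
     else if y \<le> A + \<xi> then \<kappa> * exp (- l * y)
     else normal_density A \<sigma> y)"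

lemma peak_density_measurable [measurable]: "peak_density \<sigma> A \<xi> \<kappa> l \<in> borel_measurable borel"
  unfolding peak_density_def[abs_def] by measurable

lemma peak_density_pos:
  assumes "\<sigma> > 0" "\<kappa> > 0"
  shows "peak_density \<sigma> A \<xi> \<kappa> l y > 0"
  using assms by (simp add: peak_density_def normal_density_pos)

lemma ln_normal_density:
  assumes "\<sigma> > 0"
  shows "ln (normal_density m \<sigma> y) = - ln (sqrt (2 * pi) * \<sigma>) - (y - m)\<^sup>2 / (2 * \<sigma>\<^sup>2)"
proof -
  have "sqrt (2 * pi * \<sigma>\<^sup>2) = sqrt (2 * pi) * \<sigma>"
    using assms by (simp add: real_sqrt_mult)
  then show ?thesis
    using assms by (simp add: normal_density_def ln_mult ln_div ln_sqrt)
qed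

lemma normal_density_le:
  assumes "\<sigma> > 0" and "\<bar>y - m\<bar> \<le> \<bar>y - m'\<bar>"
  shows "normal_density m' \<sigma> y \<le> normal_density m \<sigma> y"
proof -
  have "(y - m)\<^sup>2 \<le> (y - m')\<^sup>2" using assms(2) by (rule abs_le_square_iff[THEN iffD1])
  then show ?thesis
    unfolding normal_density_def using assms(1)
    by (intro mult_left_mono) (auto intro!: divide_right_mono)
qed

section \<open>Cross entropy of a Gaussian letter against the peak density\<close>

locale peak_output =
  fixes \<sigma> A \<xi> \<kappa> l :: real
  assumes sigma: "\<sigma> > 0" and A: "A > 0" and xi: "\<xi> > 0" and kappa: "\<kappa> > 0" and l: "l \<ge> 0"
begin

abbreviation "R \<equiv> peak_density \<sigma> A \<xi> \<kappa> l"

text \<open>Probability that a N(x, \<sigma>^2) output falls in the middle piece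
  [-\<xi>, A + \<xi>]; see \<open>mid_integral\<close>.\<close>

definition "mid x = 1 - Qfun ((\<xi> + x) / \<sigma>) - Qfun ((\<xi> + A - x) / \<sigma>)"

text \<open>Second moment of the standard normal law beyond \<xi> / \<sigma>. Half of it bounds the
  expected exponent on one tail, so the two tails together cost \<open>tail\<close>.\<close>

definition "tail = Qfun (\<xi> / \<sigma>) + \<xi> / (sqrt (2 * pi) * \<sigma>) * exp (- \<xi>\<^sup>2 / (2 * \<sigma>\<^sup>2))"

text \<open>Pulling the Gaussian normalisation out of all three pieces leaves one sum weighted by
  indicators, from which \<open>ln_R_bound\<close> is read off.\<close>

lemma ln_R:
  "- ln (R y) = ln (sqrt (2 * pi) * \<sigma>)
     + indicator {..<-\<xi>} y * (y\<^sup>2 / (2 * \<sigma>\<^sup>2))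
     + indicator {-\<xi>..A + \<xi>} y * (- ln (\<kappa> * (sqrt (2 * pi) * \<sigma>)) + l * y)
     + indicator {A + \<xi><..} y * ((y - A)\<^sup>2 / (2 * \<sigma>\<^sup>2))"
  using sigma A xi kappa
  by (auto simp: peak_density_def ln_normal_density ln_mult split: split_indicator)

lemma ln_R_bound: "\<exists>a b. \<forall>y. \<bar>ln (R y)\<bar> \<le> a + b * y\<^sup>2"
proof -
  let ?c = "\<bar>ln (sqrt (2 * pi) * \<sigma>)\<bar>" and ?L = "\<bar>ln (\<kappa> * (sqrt (2 * pi) * \<sigma>))\<bar>"
  have "\<bar>ln (R y)\<bar> \<le> (?c + ?L + l + 2 * A\<^sup>2 / (2 * \<sigma>\<^sup>2)) + (l + 3 / (2 * \<sigma>\<^sup>2)) * y\<^sup>2" for y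
  proof -
    have "(y - A)\<^sup>2 \<le> 2 * A\<^sup>2 + 2 * y\<^sup>2"
      using zero_le_power2[of "y + A"] by (simp add: power2_eq_square algebra_simps)
    then have 1: "(y - A)\<^sup>2 / (2 * \<sigma>\<^sup>2) \<le> (2 * A\<^sup>2 + 2 * y\<^sup>2) / (2 * \<sigma>\<^sup>2)"
      by (rule divide_right_mono) simp
    have "\<bar>y\<bar> \<le> 1 + y\<^sup>2" by (simp add: abs_le_iff power2_eq_square) (sos)
    then have 2: "l * \<bar>y\<bar> \<le> l * (1 + y\<^sup>2)" using l by (rule mult_left_mono)
    have "\<bar>ln (R y)\<bar> = \<bar>- ln (R y)\<bar>" by simp
    also have "\<dots> \<le> ?c + y\<^sup>2 / (2 * \<sigma>\<^sup>2) + (?L + l * \<bar>y\<bar>) + (y - A)\<^sup>2 / (2 * \<sigma>\<^sup>2)"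
    proof -
      \<comment> \<open>Triangle inequality over plain reals: i, j, k stand for the three
        indicators, p and q for the quadratic exponents, r for l * y.\<close>
      have "\<bar>c + i * p + j * (- L + r) + k * q\<bar> \<le> \<bar>c\<bar> + p + (\<bar>L\<bar> + \<bar>r\<bar>) + q"
        if "i \<in> {0, 1}" "j \<in> {0, 1}" "k \<in> {0, 1}" "0 \<le> p" "0 \<le> q" for c i p j L r k q :: real
        using that by auto
      moreover have "\<bar>l * y\<bar> = l * \<bar>y\<bar>" using l by (simp add: abs_mult)
      ultimately show ?thesis unfolding ln_R
        by (metis indicator_simps insert_iff zero_le_power2 zero_le_divide_iff zero_le_mult_iff zero_le_numeral)
    qed
    finally show ?thesis using 1 2 by (simp add: algebra_simps add_divide_distrib diff_divide_distrib)
  qed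
  then show ?thesis by blast
qed

lemma R_left: "y < -\<xi> \<Longrightarrow> - ln (R y) = ln (sqrt (2 * pi) * \<sigma>) + y\<^sup>2 / (2 * \<sigma>\<^sup>2)"
  and R_mid: "- \<xi> \<le> y \<Longrightarrow> y \<le> A + \<xi> \<Longrightarrow> - ln (R y) = - ln \<kappa> + l * y"
  and R_right: "A + \<xi> < y \<Longrightarrow> - ln (R y) = ln (sqrt (2 * pi) * \<sigma>) + (y - A)\<^sup>2 / (2 * \<sigma>\<^sup>2)"
  using sigma A xi kappa
  by (auto simp: peak_density_def ln_normal_density ln_mult)

lemma integrable_normal_ln_R: "integrable lborel (\<lambda>y. normal_density x \<sigma> y * ln (R y))"
proof -
  obtain a b where "\<bar>ln (R y)\<bar> \<le> a + b * y\<^sup>2" for y using ln_R_bound by blast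
  then show ?thesis by (rule integrable_normal_ln[OF sigma peak_density_measurable])
qed

text \<open>The worst input is x = 0: at y < 0 a normal density with mean x \<ge> 0 is largest when
  its mean is nearest to y.\<close>

lemma tail_left:
  assumes "0 \<le> x"
  shows "(LINT y:{..<-\<xi>}|lborel. normal_density x \<sigma> y * (y\<^sup>2 / (2 * \<sigma>\<^sup>2))) \<le> tail / 2"
proof -
  have "(LINT y:{..<-\<xi>}|lborel. normal_density x \<sigma> y * (y\<^sup>2 / (2 * \<sigma>\<^sup>2)))
      \<le> (LINT y:{..<-\<xi>}|lborel. normal_density 0 \<sigma> y * (y\<^sup>2 / (2 * \<sigma>\<^sup>2)))"
    using assms xi set_integrable_normal_square[OF sigma, of "{..<-\<xi>}" _ 0]
    by (intro set_integral_mono mult_right_mono normal_density_le[OF sigma]) auto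
  also have "\<dots> = (LINT y:{..<-\<xi>}|lborel. normal_density 0 \<sigma> y * (((0 - y) / \<sigma>)\<^sup>2 / 2))"
    by (simp add: power_divide mult.commute)
  also have "\<dots> = (LINT t:{(0 - - \<xi>) / \<sigma><..}|lborel. std_normal_density t * (t\<^sup>2 / 2))"
    by (rule normal_left_tail_std[OF sigma])
  also have "\<dots> = (Qfun (\<xi> / \<sigma>) + \<xi> / \<sigma> * std_normal_density (\<xi> / \<sigma>)) / 2"
    using std_normal_tail_second_moment[of "\<xi> / \<sigma>"] by simp
  finally show ?thesis
    by (simp add: tail_def std_normal_density_def power_divide mult.commute)
qed

text \<open>Mirror image of \<open>tail_left\<close>, with worst input x = A.\<close>

lemma tail_right:
  assumes "x \<le> A"
  shows "(LINT y:{A + \<xi><..}|lborel. normal_density x \<sigma> y * ((y - A)\<^sup>2 / (2 * \<sigma>\<^sup>2))) \<le> tail / 2"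
proof -
  have "(LINT y:{A + \<xi><..}|lborel. normal_density x \<sigma> y * ((y - A)\<^sup>2 / (2 * \<sigma>\<^sup>2)))
      \<le> (LINT y:{A + \<xi><..}|lborel. normal_density A \<sigma> y * ((y - A)\<^sup>2 / (2 * \<sigma>\<^sup>2)))"
    using assms xi
    by (intro set_integral_mono set_integrable_normal_square[OF sigma] mult_right_mono normal_density_le[OF sigma]) auto
  also have "\<dots> = (LINT y:{A + \<xi><..}|lborel. normal_density A \<sigma> y * (((y - A) / \<sigma>)\<^sup>2 / 2))"
    by (simp add: power_divide mult.commute)
  also have "\<dots> = (LINT t:{(A + \<xi> - A) / \<sigma><..}|lborel. std_normal_density t * (t\<^sup>2 / 2))"
    by (rule normal_right_tail_std[OF sigma])
  also have "\<dots> = (Qfun (\<xi> / \<sigma>) + \<xi> / \<sigma> * std_normal_density (\<xi> / \<sigma>)) / 2"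
    using std_normal_tail_second_moment[of "\<xi> / \<sigma>"] by simp
  finally show ?thesis
    by (simp add: tail_def std_normal_density_def power_divide mult.commute)
qed

text \<open>Both arguments of Q stay nonnegative for inputs in [0, A], so
  \<open>Qfun_above_tangent\<close> applies to each of them and \<open>mid\<close> is concave
  there.\<close>

lemma mid_below_tangent:
  assumes "0 \<le> x0" "x0 \<le> A" "0 \<le> x" "x \<le> A"
  shows "mid x \<le> mid x0 + (x - x0) / \<sigma> *
    (std_normal_density ((\<xi> + x0) / \<sigma>) - std_normal_density ((\<xi> + A - x0) / \<sigma>))"
proof -
  have "Qfun ((\<xi> + x) / \<sigma>) \<ge> Qfun ((\<xi> + x0) / \<sigma>)
      - ((\<xi> + x) / \<sigma> - (\<xi> + x0) / \<sigma>) * std_normal_density ((\<xi> + x0) / \<sigma>)"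
    using assms sigma xi by (intro Qfun_above_tangent) auto
  moreover have "Qfun ((\<xi> + A - x) / \<sigma>) \<ge> Qfun ((\<xi> + A - x0) / \<sigma>)
      - ((\<xi> + A - x) / \<sigma> - (\<xi> + A - x0) / \<sigma>) * std_normal_density ((\<xi> + A - x0) / \<sigma>)"
    using assms sigma xi by (intro Qfun_above_tangent) auto
  moreover have "(\<xi> + x) / \<sigma> - (\<xi> + x0) / \<sigma> = (x - x0) / \<sigma>"
    "(\<xi> + A - x) / \<sigma> - (\<xi> + A - x0) / \<sigma> = - ((x - x0) / \<sigma>)"
    by (simp_all add: diff_divide_distrib add_divide_distrib)
  ultimately show ?thesis unfolding mid_def by (simp add: right_diff_distrib)
qed

text \<open>\<open>mid\<close> is concave and symmetric about A / 2, so its tangent at that point is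
  horizontal.\<close>

lemma mid_le_half:
  assumes "0 \<le> x" "x \<le> A"
  shows "mid x \<le> mid (A / 2)"
  using mid_below_tangent[of "A / 2" x] assms by (simp add: field_simps)

lemma mid_integral:
  "(LINT y:{-\<xi>..A + \<xi>}|lborel. normal_density x \<sigma> y) = mid x"
  using normal_middle[OF sigma, of "-\<xi>" "A + \<xi>" x] A xi
  by (simp add: mid_def algebra_simps)

text \<open>Writing y = x + (y - x) isolates a centred part with an explicit antiderivative, whose
  boundary terms are worst at x = 0. Replacing \<open>mid x\<close> by its maximum makes the bound
  affine in x; this is the source of the term with \<xi> + A / 2 in c1.\<close>

lemma mid_moment:
  assumes "0 \<le> x" "x \<le> A"
  shows "(LINT y:{-\<xi>..A + \<xi>}|lborel. normal_density x \<sigma> y * y)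
    \<le> x * mid (A / 2) + \<sigma>\<^sup>2 * (normal_density 0 \<sigma> \<xi> - normal_density 0 \<sigma> (A + \<xi>))"
proof -
  have i1: "set_integrable lborel {-\<xi>..A + \<xi>} (\<lambda>y. x * normal_density x \<sigma> y)"
    by (intro set_integrable_mult_right set_integrable_normal_density[OF sigma]) auto
  have i2: "set_integrable lborel {-\<xi>..A + \<xi>} (\<lambda>y. normal_density x \<sigma> y * (y - x))"
    using set_integrable_normal_quadratic[OF sigma, of "{-\<xi>..A + \<xi>}" x "-x" 1 0] by simp
  have "(LINT y:{-\<xi>..A + \<xi>}|lborel. normal_density x \<sigma> y * y)
      = (LINT y:{-\<xi>..A + \<xi>}|lborel. x * normal_density x \<sigma> y + normal_density x \<sigma> y * (y - x))"
    by (simp add: algebra_simps)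
  also have "\<dots> = x * mid x + \<sigma>\<^sup>2 * (normal_density x \<sigma> (-\<xi>) - normal_density x \<sigma> (A + \<xi>))"
    using A xi
    by (subst set_integral_add(2)[OF i1 i2]) (simp add: mid_integral normal_middle_moment[OF sigma])
  finally have eq: "(LINT y:{-\<xi>..A + \<xi>}|lborel. normal_density x \<sigma> y * y)
    = x * mid x + \<sigma>\<^sup>2 * (normal_density x \<sigma> (-\<xi>) - normal_density x \<sigma> (A + \<xi>))" .
  have "x * mid x \<le> x * mid (A / 2)"
    using assms mid_le_half by (intro mult_left_mono) auto
  moreover have "normal_density x \<sigma> (-\<xi>) \<le> normal_density 0 \<sigma> \<xi>"
    using normal_density_le[OF sigma, of "-\<xi>" 0 x] assms xi by (simp add: normal_density_def)
  moreover have "normal_density 0 \<sigma> (A + \<xi>) \<le> normal_density x \<sigma> (A + \<xi>)"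
    using normal_density_le[OF sigma, of "A + \<xi>" x 0] assms xi A by simp
  ultimately show ?thesis unfolding eq by (intro add_mono mult_left_mono[of "a - b" for a b]) auto
qed

text \<open>Once the tails are bounded by their worst inputs, the input enters only through
  \<open>mid x\<close>, which is concave, and through a linear term.\<close>

lemma expected_ln_R:
  assumes "0 \<le> x" "x \<le> A"
  shows "(\<integral>y. normal_density x \<sigma> y * (- ln (R y)) \<partial>lborel)
    \<le> ln (sqrt (2 * pi) * \<sigma>) + tail + mid x * (- ln (\<kappa> * (sqrt (2 * pi) * \<sigma>)))
       + l * (x * mid (A / 2) + \<sigma>\<^sup>2 * (normal_density 0 \<sigma> \<xi> - normal_density 0 \<sigma> (A + \<xi>)))"
proof -
  let ?N = "normal_density x \<sigma>" and ?c = "ln (sqrt (2 * pi) * \<sigma>)"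
  have int: "set_integrable lborel S ?N" if "S \<in> sets borel" for S
    by (rule set_integrable_normal_density[OF sigma that])
  have q: "set_integrable lborel S (\<lambda>y. ?N y * (y\<^sup>2 / (2 * \<sigma>\<^sup>2)))"
    "set_integrable lborel S (\<lambda>y. ?N y * ((y - A)\<^sup>2 / (2 * \<sigma>\<^sup>2)))" if "S \<in> sets borel" for S
    using set_integrable_normal_square[OF sigma that, of x 0] set_integrable_normal_square[OF sigma that]
    by simp_all
  have m: "set_integrable lborel S (\<lambda>y. ?N y * y)" if "S \<in> sets borel" for S
    using set_integrable_normal_quadratic[OF sigma that, of x 0 1 0] by simp
  have "(LINT y:{..<-\<xi>}|lborel. ?N y * (- ln (R y)))
      = (LINT y:{..<-\<xi>}|lborel. ?c * ?N y + ?N y * (y\<^sup>2 / (2 * \<sigma>\<^sup>2)))"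
    by (intro set_lebesgue_integral_cong) (auto simp: R_left algebra_simps)
  also have "\<dots> = ?c * Qfun ((\<xi> + x) / \<sigma>) + (LINT y:{..<-\<xi>}|lborel. ?N y * (y\<^sup>2 / (2 * \<sigma>\<^sup>2)))"
    by (subst set_integral_add(2)) (auto simp: int q normal_left_tail[OF sigma] add.commute
        simp del: times_divide_eq_right)
  finally have L: "(LINT y:{..<-\<xi>}|lborel. ?N y * (- ln (R y)))
      \<le> ?c * Qfun ((\<xi> + x) / \<sigma>) + tail / 2"
    using tail_left[OF assms(1)] by linarith
  have "(LINT y:{A + \<xi><..}|lborel. ?N y * (- ln (R y)))
      = (LINT y:{A + \<xi><..}|lborel. ?c * ?N y + ?N y * ((y - A)\<^sup>2 / (2 * \<sigma>\<^sup>2)))"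
    by (intro set_lebesgue_integral_cong) (auto simp: R_right algebra_simps)
  also have "\<dots> = ?c * Qfun ((\<xi> + A - x) / \<sigma>)
      + (LINT y:{A + \<xi><..}|lborel. ?N y * ((y - A)\<^sup>2 / (2 * \<sigma>\<^sup>2)))"
    by (subst set_integral_add(2)) (auto simp: int q normal_right_tail[OF sigma] add.commute
        simp del: times_divide_eq_right)
  finally have U: "(LINT y:{A + \<xi><..}|lborel. ?N y * (- ln (R y)))
      \<le> ?c * Qfun ((\<xi> + A - x) / \<sigma>) + tail / 2"
    using tail_right[OF assms(2)] by linarith
  define k where "k = - ln \<kappa>"
  have "(LINT y:{-\<xi>..A + \<xi>}|lborel. ?N y * (- ln (R y)))
      = (LINT y:{-\<xi>..A + \<xi>}|lborel. k * ?N y + l * (?N y * y))"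
    by (intro set_lebesgue_integral_cong) (auto simp: R_mid k_def algebra_simps)
  also have "\<dots> = k * mid x + l * (LINT y:{-\<xi>..A + \<xi>}|lborel. ?N y * y)"
    by (subst set_integral_add(2)) (auto simp: int m mid_integral)
  finally have M: "(LINT y:{-\<xi>..A + \<xi>}|lborel. ?N y * (- ln (R y))) \<le> k * mid x
      + l * (x * mid (A / 2) + \<sigma>\<^sup>2 * (normal_density 0 \<sigma> \<xi> - normal_density 0 \<sigma> (A + \<xi>)))"
    using mult_left_mono[OF mid_moment[OF assms] l] by linarith
  have "- ln (\<kappa> * (sqrt (2 * pi) * \<sigma>)) = k - ?c"
    using kappa sigma by (simp add: ln_mult k_def)
  then have "mid x * (- ln (\<kappa> * (sqrt (2 * pi) * \<sigma>))) = k * mid x - ?c * mid x"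
    by (simp add: algebra_simps)
  \<comment> \<open>The masses of the three pieces add up to 1, so the Gaussian normalisation is
    paid exactly once.\<close>
  moreover have "?c * Qfun ((\<xi> + x) / \<sigma>) + ?c * Qfun ((\<xi> + A - x) / \<sigma>) + ?c * mid x = ?c"
    by (simp add: mid_def algebra_simps)
  moreover have "integrable lborel (\<lambda>y. ?N y * (- ln (R y)))"
    using integrable_normal_ln_R[of x] by simp
  ultimately show ?thesis
    using L U M normal_three_pieces[of "\<lambda>y. ?N y * (- ln (R y))" "-\<xi>" "A + \<xi>"] A xi by linarith
qed

text \<open>Each Gaussian tail has mass Q(\<xi> / \<sigma>), and the middle piece has to carry the
  rest; both choices of \<kappa> below are made to achieve this.\<close>

lemma R_integral:
  assumes "has_bochner_integral lborel (\<lambda>y. indicator {-\<xi>..A + \<xi>} y *\<^sub>R (\<kappa> * exp (- l * y))) (1 - 2 * Qfun (\<xi> / \<sigma>))"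
  shows "integrable lborel R" "(\<integral>y. R y \<partial>lborel) = 1"
proof -
  have 1: "has_bochner_integral lborel (\<lambda>y. indicator {..<-\<xi>} y *\<^sub>R normal_density 0 \<sigma> y) (Qfun (\<xi> / \<sigma>))"
    using set_integrable_normal_density[OF sigma, of "{..<-\<xi>}" 0] normal_left_tail[OF sigma, of "-\<xi>" 0]
    by (simp add: has_bochner_integral_iff set_integrable_def set_lebesgue_integral_def)
  have 2: "has_bochner_integral lborel (\<lambda>y. indicator {A + \<xi><..} y *\<^sub>R normal_density A \<sigma> y) (Qfun (\<xi> / \<sigma>))"
    using set_integrable_normal_density[OF sigma, of "{A + \<xi><..}" A] normal_right_tail[OF sigma, of "A + \<xi>" A]
    by (simp add: has_bochner_integral_iff set_integrable_def set_lebesgue_integral_def)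
  have "has_bochner_integral lborel (\<lambda>y. indicator {..<-\<xi>} y *\<^sub>R normal_density 0 \<sigma> y
      + indicator {-\<xi>..A + \<xi>} y *\<^sub>R (\<kappa> * exp (- l * y))
      + indicator {A + \<xi><..} y *\<^sub>R normal_density A \<sigma> y)
      (Qfun (\<xi> / \<sigma>) + (1 - 2 * Qfun (\<xi> / \<sigma>)) + Qfun (\<xi> / \<sigma>))"
    by (intro has_bochner_integral_add 1 2 assms)
  also have "(\<lambda>y. indicator {..<-\<xi>} y *\<^sub>R normal_density 0 \<sigma> y
      + indicator {-\<xi>..A + \<xi>} y *\<^sub>R (\<kappa> * exp (- l * y))
      + indicator {A + \<xi><..} y *\<^sub>R normal_density A \<sigma> y) = R"
    using A xi by (auto simp: peak_density_def fun_eq_iff split: split_indicator)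
  finally show "integrable lborel R" "(\<integral>y. R y \<partial>lborel) = 1"
    by (simp_all add: has_bochner_integral_iff)
qed

text \<open>The supporting line m0 + s (x - x0) of \<open>mid\<close> is left open to serve both
  branches: it touches at x0 = x1 = \<alpha> A for c1 and has slope 0 for c2. The condition
  \<open>nrm\<close> makes the coefficient - ln (\<kappa> sqrt (2 pi) \<sigma>) of
  \<open>mid\<close> nonnegative, so an upper bound on \<open>mid\<close> may be inserted, and s
  \<ge> 0 lets the average constraint act in the right direction.\<close>

lemma sum_expected_ln_R:
  fixes x :: "'i \<Rightarrow> real" and m0 s x0 x1 :: real
  assumes I: "finite I" "\<And>i. i \<in> I \<Longrightarrow> 0 \<le> x i \<and> x i \<le> A"
    and bnd: "\<And>x. 0 \<le> x \<Longrightarrow> x \<le> A \<Longrightarrow> mid x \<le> m0 + s * (x - x0)" and "0 \<le> s"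
    and small: "(\<Sum>i\<in>I. x i) \<le> real (card I) * x1" and sx: "s = 0 \<or> x1 = x0"
    and nrm: "\<kappa> * (sqrt (2 * pi) * \<sigma>) \<le> 1"
  shows "(\<Sum>i\<in>I. \<integral>y. normal_density (x i) \<sigma> y * (- ln (R y)) \<partial>lborel)
    \<le> real (card I) * (ln (sqrt (2 * pi) * \<sigma>) + tail + m0 * (- ln (\<kappa> * (sqrt (2 * pi) * \<sigma>)))
       + l * (x1 * mid (A / 2) + \<sigma>\<^sup>2 * (normal_density 0 \<sigma> \<xi> - normal_density 0 \<sigma> (A + \<xi>))))"
proof -
  let ?L = "- ln (\<kappa> * (sqrt (2 * pi) * \<sigma>))"
    and ?V = "\<sigma>\<^sup>2 * (normal_density 0 \<sigma> \<xi> - normal_density 0 \<sigma> (A + \<xi>))"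
    and ?c = "ln (sqrt (2 * pi) * \<sigma>)"
  have L: "?L \<ge> 0" using nrm kappa sigma by simp
  have mid0: "mid (A / 2) \<ge> 0"
    unfolding mid_integral[symmetric] set_lebesgue_integral_def
    by (rule integral_nonneg_AE) simp
  have "(\<Sum>i\<in>I. \<integral>y. normal_density (x i) \<sigma> y * (- ln (R y)) \<partial>lborel)
     \<le> (\<Sum>i\<in>I. ?c + tail + (m0 + s * (x i - x0)) * ?L + l * (x i * mid (A / 2) + ?V))"
    using I bnd L
    by (intro sum_mono order_trans[OF expected_ln_R] add_mono mult_right_mono order_refl) auto
  also have "\<dots> = real (card I) * (?c + tail + m0 * ?L + l * ?V) + s * ((\<Sum>i\<in>I. x i) - real (card I) * x0) * ?L
      + l * mid (A / 2) * (\<Sum>i\<in>I. x i)"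
    by (simp add: sum.distrib sum_subtractf sum_distrib_left sum_distrib_right algebra_simps)
  also have "\<dots> \<le> real (card I) * (?c + tail + m0 * ?L + l * ?V) + 0 + l * mid (A / 2) * (real (card I) * x1)"
  proof -
    have "s * ((\<Sum>i\<in>I. x i) - real (card I) * x0) * ?L \<le> 0"
      by (rule mult_nonpos_nonneg[OF _ L]) (use sx small \<open>0 \<le> s\<close> in \<open>auto simp: mult_le_0_iff\<close>)
    moreover have "l * mid (A / 2) * (\<Sum>i\<in>I. x i) \<le> l * mid (A / 2) * (real (card I) * x1)"
      using small l mid0 by (intro mult_left_mono) auto
    ultimately show ?thesis by linarith
  qed
  also have "\<dots> = real (card I) * (?c + tail + m0 * ?L + l * (x1 * mid (A / 2) + ?V))"
    by (simp add: algebra_simps)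
  finally show ?thesis .
qed

end

section \<open>The single-letter bound\<close>

text \<open>On [-\<xi>, \<xi>] the density lies between its values at \<xi> and at 0. Integrating
  the smaller constant gives positivity; the larger one gives the estimate behind \<kappa> sqrt (2
  pi) \<sigma> \<le> 1.\<close>

lemma Qfun_central_mass:
  assumes "\<sigma> > 0" "\<xi> > 0"
  shows "0 < 1 - 2 * Qfun (\<xi> / \<sigma>)"
    and "(1 - 2 * Qfun (\<xi> / \<sigma>)) * (sqrt (2 * pi) * \<sigma>) \<le> 2 * \<xi>"
proof -
  have eq: "(LINT y:{-\<xi>..\<xi>}|lborel. normal_density 0 \<sigma> y) = 1 - 2 * Qfun (\<xi> / \<sigma>)"
    using normal_middle[OF assms(1), of "-\<xi>" \<xi> 0] assms(2) by simp
  have const: "set_integrable lborel {-\<xi>..\<xi>} (\<lambda>_. c)" for c :: real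
    using assms(2) by (intro set_integrable_const) auto
  have lint: "(LINT y:{-\<xi>..\<xi>}|lborel. c) = 2 * \<xi> * c" for c :: real
    using assms(2) by (simp add: set_lebesgue_integral_def)
  have int: "set_integrable lborel {-\<xi>..\<xi>} (normal_density 0 \<sigma>)"
    by (rule set_integrable_normal_density[OF assms(1)]) simp
  have "(LINT y:{-\<xi>..\<xi>}|lborel. normal_density 0 \<sigma> \<xi>) \<le> (LINT y:{-\<xi>..\<xi>}|lborel. normal_density 0 \<sigma> y)"
  proof (rule set_integral_mono[OF const int])
    fix y assume "y \<in> {-\<xi>..\<xi>}"
    then have "y\<^sup>2 \<le> \<xi>\<^sup>2" by (intro abs_le_square_iff[THEN iffD1]) auto
    then show "normal_density 0 \<sigma> \<xi> \<le> normal_density 0 \<sigma> y"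
      unfolding normal_density_def by (intro mult_left_mono) (auto intro!: divide_right_mono)
  qed
  moreover have "0 < 2 * \<xi> * normal_density 0 \<sigma> \<xi>"
    using assms by (simp add: normal_density_pos)
  ultimately show "0 < 1 - 2 * Qfun (\<xi> / \<sigma>)" unfolding eq lint by linarith
  have "(LINT y:{-\<xi>..\<xi>}|lborel. normal_density 0 \<sigma> y) \<le> (LINT y:{-\<xi>..\<xi>}|lborel. normal_density 0 \<sigma> 0)"
    by (rule set_integral_mono[OF int const]) (auto simp: normal_density_def divide_right_mono)
  then have "1 - 2 * Qfun (\<xi> / \<sigma>) \<le> 2 * \<xi> / (sqrt (2 * pi) * \<sigma>)"
    unfolding eq lint using assms by (simp add: normal_density_def real_sqrt_mult)
  then show "(1 - 2 * Qfun (\<xi> / \<sigma>)) * (sqrt (2 * pi) * \<sigma>) \<le> 2 * \<xi>"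
    using assms by (simp add: pos_le_divide_eq)
qed

text \<open>Used at u = \<mu> \<xi> / A to bound the denominator of \<kappa> in the exponential
  kernel from below.\<close>

lemma exp_diff_ge:
  fixes u :: real
  assumes "0 \<le> u"
  shows "2 * u \<le> exp u - exp (- u)"
proof -
  have "(\<lambda>u. exp u - exp (- u) - 2 * u) 0 \<le> (\<lambda>u. exp u - exp (- u) - 2 * u) u"
  proof (rule DERIV_nonneg_imp_nondecreasing[OF assms])
    fix x :: real
    have "((\<lambda>u. exp u - exp (- u) - 2 * u) has_real_derivative exp x + exp (- x) - 2) (at x)"
      by (auto intro!: derivative_eq_intros)
    moreover have "exp x + exp (- x) \<ge> 2"
      using exp_ge_add_one_self[of x] exp_ge_add_one_self[of "-x"] by linarith
    ultimately show "\<exists>y. ((\<lambda>u. exp u - exp (- u) - 2 * u) has_real_derivative y) (at x) \<and> 0 \<le> y"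
      by fastforce
  qed
  then show ?thesis by simp
qed

text \<open>The relative entropy of the channel law N(x i, sigma^2) from R is at most c nats on
  average over any family of inputs obeying the peak and average constraints; the term
  ln (sqrt (2 * pi) * sigma) + 1 / 2 is the differential entropy of the noise. The index pairs stand
  for a message and a time instant.\<close>

definition output_kernel :: "real \<Rightarrow> real \<Rightarrow> real \<Rightarrow> real \<Rightarrow> (real \<Rightarrow> real) \<Rightarrow> bool" where
  "output_kernel \<sigma> A \<alpha> c R \<longleftrightarrow>
     R \<in> borel_measurable borel \<and> (\<forall>y. R y > 0) \<and>
     integrable lborel R \<and> (\<integral>y. R y \<partial>lborel) = 1 \<and> (\<exists>a b. \<forall>y. \<bar>ln (R y)\<bar> \<le> a + b * y\<^sup>2) \<and>
     (\<forall>I (x :: nat \<times> nat \<Rightarrow> real). finite I \<longrightarrow> (\<forall>i\<in>I. 0 \<le> x i \<and> x i \<le> A) \<longrightarrow>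
        (\<Sum>i\<in>I. x i) \<le> real (card I) * (\<alpha> * A) \<longrightarrow>
        (\<Sum>i\<in>I. \<integral>y. normal_density (x i) \<sigma> y * (- ln (R y)) \<partial>lborel)
          \<le> real (card I) * (ln (sqrt (2 * pi) * \<sigma>) + 1 / 2 + c))"

text \<open>The tangent to \<open>mid\<close> is taken at \<alpha> A, the largest mean that the
  constraint allows. For \<alpha> < 1 / 2 this point lies left of the maximum A / 2, so the slope
  has the sign that \<open>sum_expected_ln_R\<close> requires.\<close>

lemma output_kernel_exponential:
  assumes "\<sigma> > 0" "A > 0" "0 < \<alpha>" "\<alpha> < 1 / 2" "\<mu> > 0" "\<xi> > 0"
  defines "\<kappa> \<equiv> \<mu> / A * (1 - 2 * Qfun (\<xi> / \<sigma>)) / (exp (\<mu> * \<xi> / A) - exp (- \<mu> * (1 + \<xi> / A)))"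
  shows "output_kernel \<sigma> A \<alpha>
    (ln 2 * ((1 - Qfun ((\<xi> + \<alpha> * A) / \<sigma>) - Qfun ((\<xi> + (1 - \<alpha>) * A) / \<sigma>))
         * log 2 ((A / \<sigma>) * (exp (\<mu> * \<xi> / A) - exp (- \<mu> * (1 + \<xi> / A)))
                  / (sqrt (2 * pi) * \<mu> * (1 - 2 * Qfun (\<xi> / \<sigma>))))
       + log 2 (exp 1) *
         (- 1 / 2 + Qfun (\<xi> / \<sigma>)
          + \<xi> / (sqrt (2 * pi) * \<sigma>) * exp (- \<xi>\<^sup>2 / (2 * \<sigma>\<^sup>2))
          + (\<sigma> / A) * (\<mu> / sqrt (2 * pi))
              * (exp (- \<xi>\<^sup>2 / (2 * \<sigma>\<^sup>2)) - exp (- (A + \<xi>)\<^sup>2 / (2 * \<sigma>\<^sup>2)))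
          + \<mu> * \<alpha> * (1 - 2 * Qfun ((\<xi> + A / 2) / \<sigma>)))))
    (peak_density \<sigma> A \<xi> \<kappa> (\<mu> / A))"
proof -
  define l where "l = \<mu> / A"
  define E where "E = exp (\<mu> * \<xi> / A) - exp (- \<mu> * (1 + \<xi> / A))"
  define q where "q = 1 - 2 * Qfun (\<xi> / \<sigma>)"
  note q = Qfun_central_mass[OF assms(1) assms(6), folded q_def]
  have "2 * (\<mu> * \<xi> / A) \<le> exp (\<mu> * \<xi> / A) - exp (- (\<mu> * \<xi> / A))"
    using assms by (intro exp_diff_ge) auto
  also have "\<dots> \<le> E" unfolding E_def using assms by (auto simp: field_simps)
  finally have Ege: "2 * (\<mu> * \<xi> / A) \<le> E" .
  moreover have "0 < 2 * (\<mu> * \<xi> / A)" using assms by simp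
  ultimately have E: "0 < E" by linarith
  have kap: "\<kappa> = l * q / E" unfolding \<kappa>_def l_def q_def E_def ..
  have lpos: "0 < l" using assms by (simp add: l_def)
  have kpos: "\<kappa> > 0" unfolding kap using lpos q(1) E by simp
  interpret peak_output \<sigma> A \<xi> \<kappa> l
    by unfold_locales (use assms lpos kpos in auto)
  have "\<kappa> * (sqrt (2 * pi) * \<sigma>) = (l / E) * (q * (sqrt (2 * pi) * \<sigma>))" by (simp add: kap)
  also have "\<dots> \<le> (l / E) * (2 * \<xi>)" using q(2) lpos E by (intro mult_left_mono) auto
  also have "\<dots> \<le> 1"
  proof -
    have "l * (2 * \<xi>) \<le> E" using Ege by (simp add: l_def mult.assoc mult.left_commute)
    then show ?thesis using E by (simp add: divide_le_eq)
  qed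
  finally have nrm: "\<kappa> * (sqrt (2 * pi) * \<sigma>) \<le> 1" .
  have "has_bochner_integral lborel (\<lambda>y. indicator {-\<xi>..A + \<xi>} y *\<^sub>R (\<kappa> * exp (- l * y)))
      (- \<kappa> / l * exp (- l * (A + \<xi>)) - (- \<kappa> / l * exp (- l * (- \<xi>))))"
  proof (rule has_bochner_integral_FTC_Icc)
    show "((\<lambda>y. - \<kappa> / l * exp (- l * y)) has_vector_derivative \<kappa> * exp (- l * y))
        (at y within {-\<xi>..A + \<xi>})" for y
      unfolding has_real_derivative_iff_has_vector_derivative[symmetric]
      using lpos by (auto intro!: derivative_eq_intros)
  qed (use A xi in \<open>auto intro!: continuous_intros\<close>)
  moreover have "- \<kappa> / l * exp (- l * (A + \<xi>)) - (- \<kappa> / l * exp (- l * (- \<xi>))) = \<kappa> / l * E"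
  proof -
    have "- \<mu> * (1 + \<xi> / A) = - l * (A + \<xi>)" "\<mu> * \<xi> / A = - l * (- \<xi>)"
      using assms by (auto simp: l_def field_simps)
    then show ?thesis by (simp add: E_def right_diff_distrib)
  qed
  moreover have "\<kappa> / l * E = q" using lpos E by (simp add: kap)
  ultimately have R: "integrable lborel R" "(\<integral>y. R y \<partial>lborel) = 1"
    using R_integral by (simp_all add: q_def)
  define s where "s = (std_normal_density ((\<xi> + \<alpha> * A) / \<sigma>)
      - std_normal_density ((\<xi> + A - \<alpha> * A) / \<sigma>)) / \<sigma>"
  have aA: "0 \<le> \<alpha> * A" "\<alpha> * A \<le> A / 2" using assms by auto
  have "0 \<le> s"
    unfolding s_def using aA sigma xi A
    by (intro divide_nonneg_nonneg) (auto intro!: std_normal_density_antimono divide_right_mono)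
  have tangent: "mid x \<le> mid (\<alpha> * A) + s * (x - \<alpha> * A)" if "0 \<le> x" "x \<le> A" for x
    using mid_below_tangent[of "\<alpha> * A" x] aA that A by (simp add: s_def mult.commute)
  \<comment> \<open>Identifies the logarithm in c1 with the coefficient of \<open>mid\<close> in the
    cross entropy.\<close>
  have inv: "A / \<sigma> * E / (sqrt (2 * pi) * \<mu> * q) = inverse (\<kappa> * (sqrt (2 * pi) * \<sigma>))"
    unfolding kap l_def using assms E q(1) by (simp add: field_simps)
  have mid1: "1 - Qfun ((\<xi> + \<alpha> * A) / \<sigma>) - Qfun ((\<xi> + (1 - \<alpha>) * A) / \<sigma>) = mid (\<alpha> * A)"
    by (simp add: mid_def algebra_simps)
  have mid2: "1 - 2 * Qfun ((\<xi> + A / 2) / \<sigma>) = mid (A / 2)"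
  proof -
    have "\<xi> + A - A / 2 = \<xi> + A / 2" by simp
    then have "Qfun ((\<xi> + A - A / 2) / \<sigma>) = Qfun ((\<xi> + A / 2) / \<sigma>)" by (rule arg_cong)
    then show ?thesis unfolding mid_def by linarith
  qed
  have V: "\<sigma> / A * (\<mu> / sqrt (2 * pi)) * (exp (- \<xi>\<^sup>2 / (2 * \<sigma>\<^sup>2)) - exp (- (A + \<xi>)\<^sup>2 / (2 * \<sigma>\<^sup>2)))
      = l * (\<sigma>\<^sup>2 * (normal_density 0 \<sigma> \<xi> - normal_density 0 \<sigma> (A + \<xi>)))"
  proof -
    have "normal_density 0 \<sigma> y = exp (- y\<^sup>2 / (2 * \<sigma>\<^sup>2)) / (sqrt (2 * pi) * \<sigma>)" for y
      using sigma by (simp add: normal_density_def real_sqrt_mult)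
    then show ?thesis
      using sigma by (simp add: l_def diff_divide_distrib[symmetric] power2_eq_square)
  qed
  \<comment> \<open>Conversion from the bits of c1 to the nats of
    \<open>output_kernel\<close>.\<close>
  have ln2: "ln 2 * (a * log 2 b + log 2 (exp 1) * c) = a * ln b + c" for a b c :: real
    by (simp add: log_def algebra_simps)
  show ?thesis
    unfolding output_kernel_def ln2
    unfolding E_def[symmetric] q_def[symmetric] l_def[symmetric] inv mid1 mid2 V
  proof (intro conjI allI impI)
    show "R \<in> borel_measurable borel" by measurable
    show "R y > 0" for y by (rule peak_density_pos[OF sigma kappa])
    fix I and x :: "nat \<times> nat \<Rightarrow> real"
    assume "finite I" "\<forall>i\<in>I. 0 \<le> x i \<and> x i \<le> A" "(\<Sum>i\<in>I. x i) \<le> real (card I) * (\<alpha> * A)"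
    then have "(\<Sum>i\<in>I. \<integral>y. normal_density (x i) \<sigma> y * (- ln (R y)) \<partial>lborel)
    \<le> real (card I) * (ln (sqrt (2 * pi) * \<sigma>) + tail + mid (\<alpha> * A) * (- ln (\<kappa> * (sqrt (2 * pi) * \<sigma>)))
       + l * (\<alpha> * A * mid (A / 2) + \<sigma>\<^sup>2 * (normal_density 0 \<sigma> \<xi> - normal_density 0 \<sigma> (A + \<xi>))))"
      by (intro sum_expected_ln_R[OF _ _ tangent \<open>0 \<le> s\<close>]) (use nrm in auto)
    also have "\<dots> = real (card I) * (ln (sqrt (2 * pi) * \<sigma>) + 1 / 2 +
      (mid (\<alpha> * A) * ln (inverse (\<kappa> * (sqrt (2 * pi) * \<sigma>))) +
       (- 1 / 2 + Qfun (\<xi> / \<sigma>) + \<xi> / (sqrt (2 * pi) * \<sigma>) * exp (- \<xi>\<^sup>2 / (2 * \<sigma>\<^sup>2)) +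
         l * (\<sigma>\<^sup>2 * (normal_density 0 \<sigma> \<xi> - normal_density 0 \<sigma> (A + \<xi>))) +
         \<mu> * \<alpha> * mid (A / 2))))"
    proof -
      have "l * (\<alpha> * A * mid (A / 2)) = \<mu> * \<alpha> * mid (A / 2)" using A by (simp add: l_def)
      then show ?thesis
        unfolding tail_def ln_inverse distrib_left[of l]
        by (intro arg_cong[where f = "\<lambda>z. real (card I) * z"]) linarith
    qed
    finally show "(\<Sum>i\<in>I. \<integral>y. normal_density (x i) \<sigma> y * (- ln (R y)) \<partial>lborel) \<le> \<dots>" .
  qed (use R ln_R_bound in auto)
qed

text \<open>The tangent to \<open>mid\<close> at its maximum A / 2 is flat, so the slope is 0. The
  middle piece is uniform on an interval of length A + 2 \<xi>, which gives the denominator of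
  \<kappa>.\<close>

lemma output_kernel_uniform:
  assumes "\<sigma> > 0" "A > 0" "0 < \<alpha>" "\<alpha> \<le> 1" "\<xi> > 0"
  defines "\<kappa> \<equiv> (1 - 2 * Qfun (\<xi> / \<sigma>)) / (A + 2 * \<xi>)"
  shows "output_kernel \<sigma> A \<alpha>
    (ln 2 * ((1 - 2 * Qfun ((\<xi> + A / 2) / \<sigma>))
         * log 2 ((A + 2 * \<xi>) / (\<sigma> * sqrt (2 * pi) * (1 - 2 * Qfun (\<xi> / \<sigma>))))
       + log 2 (exp 1) *
         (- 1 / 2 + Qfun (\<xi> / \<sigma>)
          + \<xi> / (sqrt (2 * pi) * \<sigma>) * exp (- \<xi>\<^sup>2 / (2 * \<sigma>\<^sup>2)))))
    (peak_density \<sigma> A \<xi> \<kappa> 0)"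
proof -
  define q where "q = 1 - 2 * Qfun (\<xi> / \<sigma>)"
  note q = Qfun_central_mass[OF assms(1) assms(5), folded q_def]
  have kap: "\<kappa> = q / (A + 2 * \<xi>)" unfolding \<kappa>_def q_def ..
  have kpos: "\<kappa> > 0" unfolding kap using assms q by simp
  interpret peak_output \<sigma> A \<xi> \<kappa> 0
    by unfold_locales (use assms kpos in auto)
  have "\<kappa> * (sqrt (2 * pi) * \<sigma>) = q * (sqrt (2 * pi) * \<sigma>) / (A + 2 * \<xi>)" by (simp add: kap)
  also have "\<dots> \<le> 1" using q(2) assms by simp
  finally have nrm: "\<kappa> * (sqrt (2 * pi) * \<sigma>) \<le> 1" .
  have "has_bochner_integral lborel (\<lambda>y. indicator {-\<xi>..A + \<xi>} y *\<^sub>R \<kappa>)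
      (\<kappa> * (A + \<xi>) - \<kappa> * (- \<xi>))"
  proof (rule has_bochner_integral_FTC_Icc)
    show "((\<lambda>y. \<kappa> * y) has_vector_derivative \<kappa>) (at y within {-\<xi>..A + \<xi>})" for y
      unfolding has_real_derivative_iff_has_vector_derivative[symmetric]
      by (auto intro!: derivative_eq_intros)
  qed (use A xi in \<open>auto intro!: continuous_intros\<close>)
  moreover have "\<kappa> * (A + \<xi>) - \<kappa> * (- \<xi>) = q"
  proof -
    have "\<kappa> * (A + \<xi>) - \<kappa> * (- \<xi>) = \<kappa> * (A + 2 * \<xi>)" by (simp add: algebra_simps)
    then show ?thesis using A xi by (simp add: kap)
  qed
  ultimately have R: "integrable lborel R" "(\<integral>y. R y \<partial>lborel) = 1"
    using R_integral by (simp_all add: q_def)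
  have half: "mid x \<le> mid (A / 2) + 0 * (x - 0)" if "0 \<le> x" "x \<le> A" for x
    using mid_le_half[OF that] by simp
  have inv: "(A + 2 * \<xi>) / (\<sigma> * sqrt (2 * pi) * q) = inverse (\<kappa> * (sqrt (2 * pi) * \<sigma>))"
    unfolding kap using assms q(1) by (simp add: field_simps)
  have mid2: "1 - 2 * Qfun ((\<xi> + A / 2) / \<sigma>) = mid (A / 2)"
  proof -
    have "\<xi> + A - A / 2 = \<xi> + A / 2" by simp
    then have "Qfun ((\<xi> + A - A / 2) / \<sigma>) = Qfun ((\<xi> + A / 2) / \<sigma>)" by (rule arg_cong)
    then show ?thesis unfolding mid_def by linarith
  qed
  have ln2: "ln 2 * (a * log 2 b + log 2 (exp 1) * c) = a * ln b + c" for a b c :: real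
    by (simp add: log_def algebra_simps)
  show ?thesis
    unfolding output_kernel_def ln2
    unfolding q_def[symmetric] inv mid2
  proof (intro conjI allI impI)
    show "R \<in> borel_measurable borel" by measurable
    show "R y > 0" for y by (rule peak_density_pos[OF sigma kappa])
    fix I and x :: "nat \<times> nat \<Rightarrow> real"
    assume I: "finite I" "\<forall>i\<in>I. 0 \<le> x i \<and> x i \<le> A" "(\<Sum>i\<in>I. x i) \<le> real (card I) * (\<alpha> * A)"
    have "(\<Sum>i\<in>I. \<integral>y. normal_density (x i) \<sigma> y * (- ln (R y)) \<partial>lborel)
    \<le> real (card I) * (ln (sqrt (2 * pi) * \<sigma>) + tail + mid (A / 2) * (- ln (\<kappa> * (sqrt (2 * pi) * \<sigma>)))
       + 0 * (\<alpha> * A * mid (A / 2) + \<sigma>\<^sup>2 * (normal_density 0 \<sigma> \<xi> - normal_density 0 \<sigma> (A + \<xi>))))"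
      by (rule sum_expected_ln_R[where s = 0, OF _ _ half]) (use I nrm in auto)
    also have "\<dots> = real (card I) * (ln (sqrt (2 * pi) * \<sigma>) + 1 / 2 +
      (mid (A / 2) * ln (inverse (\<kappa> * (sqrt (2 * pi) * \<sigma>))) +
       (- 1 / 2 + Qfun (\<xi> / \<sigma>) + \<xi> / (sqrt (2 * pi) * \<sigma>) * exp (- \<xi>\<^sup>2 / (2 * \<sigma>\<^sup>2)))))"
      unfolding tail_def ln_inverse
      by (intro arg_cong[where f = "\<lambda>z. real (card I) * z"]) linarith
    finally show "(\<Sum>i\<in>I. \<integral>y. normal_density (x i) \<sigma> y * (- ln (R y)) \<partial>lborel) \<le> \<dots>" .
  qed (use R ln_R_bound in auto)
qed

lemma output_kernel_mono:
  assumes "output_kernel \<sigma> A \<alpha> c R" "c \<le> c'"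
  shows "output_kernel \<sigma> A \<alpha> c' R"
proof -
  have "real k * (ln (sqrt (2 * pi) * \<sigma>) + 1 / 2 + c) \<le> real k * (ln (sqrt (2 * pi) * \<sigma>) + 1 / 2 + c')" for k
    using assms(2) by (intro mult_left_mono) auto
  then show ?thesis
    using assms(1) unfolding output_kernel_def by (meson order_trans)
qed

text \<open>An infimum need not be attained, but some parameters come within e of it or below, and
  their kernel serves. The slack e is removed later by \<open>field_le_epsilon\<close>.\<close>

lemma output_kernel_exists:
  assumes "\<sigma> > 0" "A > 0" "0 < \<alpha>" "\<alpha> \<le> 1" "e > 0"
  shows "\<exists>R. output_kernel \<sigma> A \<alpha> (ln 2 * (Cbar \<sigma> A \<alpha> + e)) R"
proof (cases "\<alpha> < 1 / 2")
  case True
  have "Cbar1 \<sigma> A \<alpha> < Cbar \<sigma> A \<alpha> + e" using True assms by (simp add: Cbar_def)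
  then obtain p where "fst p > 0" "snd p > 0" and *:
    "(let \<mu> = fst p; \<xi> = snd p in
       (1 - Qfun ((\<xi> + \<alpha> * A) / \<sigma>) - Qfun ((\<xi> + (1 - \<alpha>) * A) / \<sigma>))
         * log 2 ((A / \<sigma>) * (exp (\<mu> * \<xi> / A) - exp (- \<mu> * (1 + \<xi> / A)))
                  / (sqrt (2 * pi) * \<mu> * (1 - 2 * Qfun (\<xi> / \<sigma>))))
       + log 2 (exp 1) *
         (- 1 / 2 + Qfun (\<xi> / \<sigma>)
          + \<xi> / (sqrt (2 * pi) * \<sigma>) * exp (- \<xi>\<^sup>2 / (2 * \<sigma>\<^sup>2))
          + (\<sigma> / A) * (\<mu> / sqrt (2 * pi))
              * (exp (- \<xi>\<^sup>2 / (2 * \<sigma>\<^sup>2)) - exp (- (A + \<xi>)\<^sup>2 / (2 * \<sigma>\<^sup>2)))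
          + \<mu> * \<alpha> * (1 - 2 * Qfun ((\<xi> + A / 2) / \<sigma>)))) < Cbar \<sigma> A \<alpha> + e"
    unfolding Cbar1_def
    by (drule_tac cInf_lessD[rotated]) (auto intro!: exI[of _ "1::real"])
  show ?thesis
    by (rule exI, rule output_kernel_mono[OF output_kernel_exponential[of \<sigma> A \<alpha> "fst p" "snd p"]])
      (use assms True \<open>fst p > 0\<close> \<open>snd p > 0\<close> less_imp_le[OF *[unfolded Let_def]] in auto)
next
  case False
  have "Cbar2 \<sigma> A < Cbar \<sigma> A \<alpha> + e" using False assms by (simp add: Cbar_def)
  then obtain \<xi> where "\<xi> > 0" and *:
    "(1 - 2 * Qfun ((\<xi> + A / 2) / \<sigma>))
         * log 2 ((A + 2 * \<xi>) / (\<sigma> * sqrt (2 * pi) * (1 - 2 * Qfun (\<xi> / \<sigma>))))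
       + log 2 (exp 1) *
         (- 1 / 2 + Qfun (\<xi> / \<sigma>)
          + \<xi> / (sqrt (2 * pi) * \<sigma>) * exp (- \<xi>\<^sup>2 / (2 * \<sigma>\<^sup>2))) < Cbar \<sigma> A \<alpha> + e"
    unfolding Cbar2_def
    by (drule_tac cInf_lessD[rotated]) auto
  show ?thesis
    by (rule exI, rule output_kernel_mono[OF output_kernel_uniform[of \<sigma> A \<alpha> \<xi>]])
      (use assms \<open>\<xi> > 0\<close> less_imp_le[OF *] in auto)
qed

section \<open>Relative entropy converse and Gaussian product laws\<close>

text \<open>This is ln z \<le> z - 1 at z = q exp c / p. Integrated, it becomes a Donsker-Varadhan
  type inequality with test function c.\<close>

lemma scaled_log_sum:
  fixes p q c :: real
  assumes "0 < p" "0 < q"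
  shows "p - q * exp c \<le> p * (ln p - ln q - c)"
proof -
  have "ln (q * exp c / p) \<le> q * exp c / p - 1"
    using assms by (intro ln_le_minus_one) auto
  then have "p * (ln q + c - ln p) \<le> p * (q * exp c / p - 1)"
    using assms by (intro mult_left_mono) (auto simp: ln_mult ln_div)
  then show ?thesis using assms by (simp add: algebra_simps)
qed

text \<open>Tilting q by the factor M on the set
  decoded to m keeps its total mass over all M hypotheses at most 2 M; then ln x \<le> x - 1.\<close>

lemma decoder_converse:
  fixes p :: "nat \<Rightarrow> 'a \<Rightarrow> real" and q :: "'a \<Rightarrow> real"
  assumes M: "M > 0"
    and p_pos: "\<And>m y. m \<in> {1..M} \<Longrightarrow> y \<in> space B \<Longrightarrow> 0 < p m y"
    and q_pos: "\<And>y. y \<in> space B \<Longrightarrow> 0 < q y"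
    and p_int: "\<And>m. m \<in> {1..M} \<Longrightarrow> integrable B (p m)" "\<And>m. m \<in> {1..M} \<Longrightarrow> (\<integral>y. p m y \<partial>B) = 1"
    and q_int: "integrable B q" "(\<integral>y. q y \<partial>B) = 1"
    and kl: "\<And>m. m \<in> {1..M} \<Longrightarrow> integrable B (\<lambda>y. p m y * (ln (p m y) - ln (q y)))"
    and g: "\<And>m. m \<in> {1..M} \<Longrightarrow> {y \<in> space B. g y = m} \<in> sets B"
  shows "ln M * (\<Sum>m\<in>{1..M}. \<integral>y. indicator {y \<in> space B. g y = m} y * p m y \<partial>B) - M
    \<le> (\<Sum>m\<in>{1..M}. \<integral>y. p m y * (ln (p m y) - ln (q y)) \<partial>B)"
proof -
  let ?D = "\<lambda>m. {y \<in> space B. g y = m}"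
  have ind_int: "integrable B (\<lambda>y. indicator (?D m) y * p m y)" if "m \<in> {1..M}" for m
    using integrable_mult_indicator[OF g[OF that] p_int(1)[OF that]] by simp
  \<comment> \<open>A decoder names one message, so the decoding sets are disjoint.\<close>
  have ind_sum: "(\<Sum>m\<in>{1..M}. indicator (?D m) y :: real) \<le> 1" for y
  proof -
    have "(\<Sum>m\<in>{1..M}. indicator (?D m) y :: real) \<le> (\<Sum>m\<in>{1..M}. if m = g y then 1 else 0)"
      by (intro sum_mono) (auto split: split_indicator)
    also have "\<dots> \<le> 1" by simp
    finally show ?thesis .
  qed
  have pw: "(\<Sum>m\<in>{1..M}. p m y) - 2 * real M * q y
     \<le> (\<Sum>m\<in>{1..M}. p m y * (ln (p m y) - ln (q y)) - ln M * (indicator (?D m) y * p m y))"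
    if y: "y \<in> space B" for y
  proof -
    have "p m y - q y * (1 + real M * indicator (?D m) y)
      \<le> p m y * (ln (p m y) - ln (q y)) - ln M * (indicator (?D m) y * p m y)" if m: "m \<in> {1..M}" for m
    proof -
      have "p m y - q y * exp (ln M * indicator (?D m) y)
        \<le> p m y * (ln (p m y) - ln (q y) - ln M * indicator (?D m) y)"
        by (rule scaled_log_sum) (use p_pos q_pos m y in auto)
      \<comment> \<open>Replacing the exponential by an expression affine in the indicator lets the
        sum over m use disjointness.\<close>
      moreover have "exp (ln M * indicator (?D m) y) \<le> 1 + real M * indicator (?D m) y"
        using M by (auto split: split_indicator)
      then have "q y * exp (ln M * indicator (?D m) y) \<le> q y * (1 + real M * indicator (?D m) y)"
        using q_pos[OF y] by (intro mult_left_mono) auto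
      ultimately show ?thesis by (simp add: algebra_simps)
    qed
    then have "(\<Sum>m\<in>{1..M}. p m y - q y * (1 + real M * indicator (?D m) y))
      \<le> (\<Sum>m\<in>{1..M}. p m y * (ln (p m y) - ln (q y)) - ln M * (indicator (?D m) y * p m y))"
      by (rule sum_mono)
    moreover have "(\<Sum>m\<in>{1..M}. p m y - q y * (1 + real M * indicator (?D m) y))
      = (\<Sum>m\<in>{1..M}. p m y) - q y * real M - q y * real M * (\<Sum>m\<in>{1..M}. indicator (?D m) y)"
      by (simp add: sum_subtractf sum.distrib sum_distrib_left algebra_simps)
    moreover have "q y * real M * (\<Sum>m\<in>{1..M}. indicator (?D m) y) \<le> q y * real M * 1"
      using ind_sum q_pos[OF y] by (intro mult_left_mono) auto
    moreover have "2 * real M * q y = q y * real M + q y * real M * 1" by simp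
    ultimately show ?thesis by linarith
  qed
  have "(\<integral>y. (\<Sum>m\<in>{1..M}. p m y) - 2 * real M * q y \<partial>B)
    \<le> (\<integral>y. (\<Sum>m\<in>{1..M}. p m y * (ln (p m y) - ln (q y)) - ln M * (indicator (?D m) y * p m y)) \<partial>B)"
    by (intro integral_mono pw Bochner_Integration.integrable_diff Bochner_Integration.integrable_sum
        p_int(1) kl integrable_mult_right ind_int q_int(1)) auto
  also have "\<dots> = (\<Sum>m\<in>{1..M}. (\<integral>y. p m y * (ln (p m y) - ln (q y)) \<partial>B)
      - ln M * (\<integral>y. indicator (?D m) y * p m y \<partial>B))"
    using kl ind_int
    by (subst Bochner_Integration.integral_sum)
       (auto simp: Bochner_Integration.integral_diff intro!: sum.cong)
  also have "(\<integral>y. (\<Sum>m\<in>{1..M}. p m y) - 2 * real M * q y \<partial>B) = - real M"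
    using p_int q_int
    by (subst Bochner_Integration.integral_diff)
       (auto simp: Bochner_Integration.integral_sum)
  finally show ?thesis by (simp add: sum_subtractf sum_distrib_left)
qed

section \<open>Gaussian product laws on n letters\<close>

abbreviation lborel_pow :: "nat \<Rightarrow> (nat \<Rightarrow> real) measure" where
  "lborel_pow n \<equiv> PiM {..<n} (\<lambda>_. lborel)"

definition gauss :: "real \<Rightarrow> nat \<Rightarrow> (nat \<Rightarrow> real) \<Rightarrow> (nat \<Rightarrow> real) \<Rightarrow> real" where
  "gauss \<sigma> n a y = (\<Prod>t<n. normal_density (a t) \<sigma> (y t))"

lemma product_lborel: "product_sigma_finite (\<lambda>_::nat. lborel :: real measure)"
  by unfold_locales

lemma gauss_measurable [measurable]: "gauss \<sigma> n a \<in> borel_measurable (lborel_pow n)"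
  unfolding gauss_def[abs_def] by measurable

lemma gauss_pos: "\<sigma> > 0 \<Longrightarrow> gauss \<sigma> n a y > 0"
  unfolding gauss_def by (intro prod_pos) (simp add: normal_density_pos)

lemma sets_out_dist [measurable_cong, simp]: "sets (out_dist \<sigma> n a) = sets (lborel_pow n)"
  unfolding out_dist_def by (intro sets_PiM_cong) auto

lemma space_out_dist [simp]: "space (out_dist \<sigma> n a) = space (lborel_pow n)"
  by (rule sets_eq_imp_space_eq) simp

lemma prob_space_out_dist: "\<sigma> > 0 \<Longrightarrow> prob_space (out_dist \<sigma> n a)"
  unfolding out_dist_def by (intro prob_space_PiM prob_space_normal_density)

text \<open>Boxes generate the product sigma-algebra and the coordinate laws are probabilities, so
  the values on boxes determine the measure.\<close>

lemma out_dist_eqI: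
  assumes "\<sigma> > 0" "sets P = sets (lborel_pow n)"
    and "\<And>A. (\<And>t. t < n \<Longrightarrow> A t \<in> sets borel) \<Longrightarrow>
      emeasure P (Pi\<^sub>E {..<n} A) = (\<Prod>t<n. emeasure (density lborel (normal_density (a t) \<sigma>)) (A t))"
  shows "P = out_dist \<sigma> n a"
proof -
  interpret N: product_prob_space "\<lambda>t. density lborel (normal_density (a t) \<sigma>)"
    by (intro product_prob_spaceI prob_space_normal_density assms(1))
  show ?thesis
    unfolding out_dist_def
  proof (rule N.PiM_eqI)
    show "sets P = sets (PiM {..<n} (\<lambda>t. density lborel (normal_density (a t) \<sigma>)))"
      using assms(2) sets_out_dist[of \<sigma> n a] by (simp add: out_dist_def)
  qed (use assms(3) in auto)
qed

lemma out_dist_density: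
  assumes "\<sigma> > 0"
  shows "out_dist \<sigma> n a = density (lborel_pow n) (gauss \<sigma> n a)"
proof (rule out_dist_eqI[OF assms, symmetric])
  interpret product_sigma_finite "\<lambda>_::nat. lborel :: real measure" by (rule product_lborel)
  fix A :: "nat \<Rightarrow> real set" assume A: "\<And>t. t < n \<Longrightarrow> A t \<in> sets borel"
  have [measurable]: "Pi\<^sub>E {..<n} A \<in> sets (lborel_pow n)"
    using A by (intro sets_PiM_I_finite) auto
  have "emeasure (density (lborel_pow n) (gauss \<sigma> n a)) (Pi\<^sub>E {..<n} A)
     = (\<integral>\<^sup>+y. ennreal (gauss \<sigma> n a y) * indicator (Pi\<^sub>E {..<n} A) y \<partial>lborel_pow n)"
    by (rule emeasure_density) measurable
  also have "\<dots> = (\<integral>\<^sup>+y. (\<Prod>t<n. ennreal (normal_density (a t) \<sigma> (y t)) * indicator (A t) (y t)) \<partial>lborel_pow n)"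
  proof (rule nn_integral_cong)
    fix y assume "y \<in> space (lborel_pow n)"
    \<comment> \<open>Points of the product space are \<open>undefined\<close> outside {..<n}, so
      only the coordinates below n decide membership in the box.\<close>
    then have ext: "y \<in> extensional {..<n}" by (simp add: space_PiM PiE_def)
    have "indicator (Pi\<^sub>E {..<n} A) y = (\<Prod>t<n. indicator (A t) (y t) :: ennreal)"
    proof (cases "y \<in> Pi\<^sub>E {..<n} A")
      case False
      then obtain t where "t < n" "y t \<notin> A t" using ext by (auto simp: PiE_def)
      then have "(\<Prod>t<n. indicator (A t) (y t) :: ennreal) = 0"
        by (intro prod_zero bexI[of _ t]) auto
      then show ?thesis using False by simp
    qed (auto simp: PiE_def Pi_def)
    then show "ennreal (gauss \<sigma> n a y) * indicator (Pi\<^sub>E {..<n} A) y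
      = (\<Prod>t<n. ennreal (normal_density (a t) \<sigma> (y t)) * indicator (A t) (y t))"
      by (simp add: gauss_def prod.distrib prod_ennreal)
  qed
  also have "\<dots> = (\<Prod>t<n. \<integral>\<^sup>+y. ennreal (normal_density (a t) \<sigma> y) * indicator (A t) y \<partial>lborel)"
    using A by (intro product_nn_integral_prod) auto
  also have "\<dots> = (\<Prod>t<n. emeasure (density lborel (normal_density (a t) \<sigma>)) (A t))"
    using A by (intro prod.cong refl emeasure_density[symmetric]) auto
  finally show "emeasure (density (lborel_pow n) (gauss \<sigma> n a)) (Pi\<^sub>E {..<n} A) = \<dots>" .
qed simp

lemma out_dist_component:
  assumes "\<sigma> > 0" "t < n"
  shows "distributed (out_dist \<sigma> n a) lborel (\<lambda>y. y t) (normal_density (a t) \<sigma>)"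
proof -
  have "distr (out_dist \<sigma> n a) lborel (\<lambda>y. y t)
    = distr (out_dist \<sigma> n a) (density lborel (normal_density (a t) \<sigma>)) (\<lambda>y. y t)"
    by (rule distr_cong) auto
  also have "\<dots> = density lborel (normal_density (a t) \<sigma>)"
    unfolding out_dist_def
    by (rule distr_PiM_component) (use assms prob_space_normal_density in auto)
  finally show ?thesis
    unfolding distributed_def using assms by simp
qed

lemma normal_density_shift:
  assumes "\<sigma> > 0"
  shows "distr (density lborel (normal_density m \<sigma>)) lborel (\<lambda>x. x + d)
    = density lborel (normal_density (m + d) \<sigma>)"
proof -
  interpret prob_space "density lborel (normal_density m \<sigma>)"
    by (rule prob_space_normal_density[OF assms])
  have "distributed (density lborel (normal_density m \<sigma>)) lborel (\<lambda>x. x) (normal_density m \<sigma>)"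
    unfolding distributed_def by (auto simp: distr_id2)
  from normal_density_affine[OF this assms, of 1 d] show ?thesis
    by (simp add: distributed_def add.commute)
qed

text \<open>Restricting the translate to {..<n} keeps it in the product space. On boxes the claim
  reduces to \<open>normal_density_shift\<close> in each coordinate.\<close>

lemma out_dist_shift:
  assumes "\<sigma> > 0"
  shows "distr (out_dist \<sigma> n a) (lborel_pow n) (\<lambda>y. \<lambda>t\<in>{..<n}. y t + d t)
    = out_dist \<sigma> n (\<lambda>t. a t + d t)"
proof (rule out_dist_eqI[OF assms])
  interpret N: product_prob_space "\<lambda>t. density lborel (normal_density (a t) \<sigma>)"
    by (intro product_prob_spaceI prob_space_normal_density assms(1))
  fix A :: "nat \<Rightarrow> real set" assume A: "\<And>t. t < n \<Longrightarrow> A t \<in> sets borel"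
  let ?T = "\<lambda>y. \<lambda>t\<in>{..<n}. y t + d t"
  have T[measurable]: "?T \<in> out_dist \<sigma> n a \<rightarrow>\<^sub>M lborel_pow n" by measurable
  have "Pi\<^sub>E {..<n} A \<in> sets (lborel_pow n)"
    using A by (intro sets_PiM_I_finite) auto
  then have "emeasure (distr (out_dist \<sigma> n a) (lborel_pow n) ?T) (Pi\<^sub>E {..<n} A)
    = emeasure (out_dist \<sigma> n a) (?T -` Pi\<^sub>E {..<n} A \<inter> space (out_dist \<sigma> n a))"
    by (intro emeasure_distr T)
  also have "?T -` Pi\<^sub>E {..<n} A \<inter> space (out_dist \<sigma> n a) = Pi\<^sub>E {..<n} (\<lambda>t. (\<lambda>x. x + d t) -` A t)"
    by (auto simp: space_PiM PiE_def Pi_def extensional_def)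
  also have "emeasure (out_dist \<sigma> n a) \<dots>
    = (\<Prod>t<n. emeasure (density lborel (normal_density (a t) \<sigma>)) ((\<lambda>x. x + d t) -` A t))"
    unfolding out_dist_def
    by (rule N.emeasure_PiM) (use A in \<open>auto intro!: measurable_sets_borel[of _ borel]\<close>)
  also have "\<dots> = (\<Prod>t<n. emeasure (density lborel (normal_density (a t + d t) \<sigma>)) (A t))"
    using A unfolding normal_density_shift[OF assms, symmetric]
    by (intro prod.cong refl) (subst emeasure_distr, auto)
  finally show "emeasure (distr (out_dist \<sigma> n a) (lborel_pow n) ?T) (Pi\<^sub>E {..<n} A) = \<dots>" .
qed simp

lemma integral_out_dist_shift:
  fixes f :: "(nat \<Rightarrow> real) \<Rightarrow> real"
  assumes "\<sigma> > 0" and "f \<in> borel_measurable (lborel_pow n)"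
  shows "(\<integral>y. f y \<partial>out_dist \<sigma> n (\<lambda>t. a t + d t))
    = (\<integral>y. f (\<lambda>t\<in>{..<n}. y t + d t) \<partial>out_dist \<sigma> n a)"
  unfolding out_dist_shift[OF assms(1), symmetric]
  by (rule integral_distr) (use assms(2) in measurable)

lemma out_dist_component_integral:
  assumes "\<sigma> > 0" "t < n" and [measurable]: "f \<in> borel_measurable borel"
  shows "(\<integral>y. f (y t) \<partial>out_dist \<sigma> n a) = (\<integral>x. normal_density (a t) \<sigma> x * f x \<partial>lborel)"
    and "integrable (out_dist \<sigma> n a) (\<lambda>y. f (y t)) \<longleftrightarrow>
      integrable lborel (\<lambda>x. normal_density (a t) \<sigma> x * (f x :: real))"
  using distributed_integral[OF out_dist_component[OF assms(1,2), of a], of f]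
    distributed_integrable[OF out_dist_component[OF assms(1,2), of a], of f] by auto

lemma ln_gauss:
  assumes "\<sigma> > 0"
  shows "ln (gauss \<sigma> n a y) = (\<Sum>t<n. ln (normal_density (a t) \<sigma> (y t)))"
  unfolding gauss_def using normal_density_pos[OF assms]
  by (intro ln_prod) (auto simp: less_le)

lemma normal_ln_normal:
  assumes "\<sigma> > 0"
  shows "integrable lborel (\<lambda>y. normal_density m \<sigma> y * ln (normal_density m' \<sigma> y))"
    and "(\<integral>y. normal_density m \<sigma> y * ln (normal_density m \<sigma> y) \<partial>lborel)
      = - (ln (sqrt (2 * pi) * \<sigma>) + 1 / 2)"
proof -
  let ?c = "ln (sqrt (2 * pi) * \<sigma>)"
  have "ln (normal_density m' \<sigma> y) = (- ?c - m'\<^sup>2 / (2 * \<sigma>\<^sup>2)) + (2 * m' / (2 * \<sigma>\<^sup>2)) * y + (- 1 / (2 * \<sigma>\<^sup>2)) * y\<^sup>2" for y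
    using assms by (simp add: ln_normal_density power2_diff diff_divide_distrib add_divide_distrib)
  then show "integrable lborel (\<lambda>y. normal_density m \<sigma> y * ln (normal_density m' \<sigma> y))"
    using integrable_normal_quadratic[OF assms] by presburger
  have "(\<integral>y. normal_density m \<sigma> y * ln (normal_density m \<sigma> y) \<partial>lborel)
    = (\<integral>y. (- ?c) * normal_density m \<sigma> y
        - (1 / (2 * \<sigma>\<^sup>2)) * (normal_density m \<sigma> y * (y - m) ^ (2 * 1)) \<partial>lborel)"
    by (intro Bochner_Integration.integral_cong refl)
       (simp add: ln_normal_density[OF assms] right_diff_distrib mult.commute)
  \<comment> \<open>The fraction with factorials is the even-moment formula at exponent 2. It equals
    \<sigma>^2, so the quadratic term contributes 1 / 2.\<close>
  also have "\<dots> = (- ?c) * 1 - (1 / (2 * \<sigma>\<^sup>2)) * (fact (2 * 1) / ((2 / \<sigma>\<^sup>2) ^ 1 * fact 1))"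
    using integrable_normal_moment[OF assms, of m "2 * 1"] integrable_normal_density[OF assms, of m]
    by (subst Bochner_Integration.integral_diff)
       (simp_all only: integrable_mult_right integral_mult_right_zero
          integral_normal_density[OF assms] integral_normal_moment_even[OF assms])
  also have "\<dots> = - (?c + 1 / 2)" using assms by (simp add: power2_eq_square)
  finally show "(\<integral>y. normal_density m \<sigma> y * ln (normal_density m \<sigma> y) \<partial>lborel) = - (?c + 1 / 2)" .
qed

lemma integrable_ln_gauss:
  assumes "\<sigma> > 0"
  shows "integrable (out_dist \<sigma> n b) (\<lambda>y. ln (gauss \<sigma> n a y))"
  unfolding ln_gauss[OF assms]
  by (intro Bochner_Integration.integrable_sum)
     (subst out_dist_component_integral(2), use assms normal_ln_normal(1) in auto)

lemma integral_ln_gauss: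
  assumes "\<sigma> > 0"
  shows "(\<integral>y. ln (gauss \<sigma> n a y) \<partial>out_dist \<sigma> n a) = - real n * (ln (sqrt (2 * pi) * \<sigma>) + 1 / 2)"
proof -
  have "(\<integral>y. ln (gauss \<sigma> n a y) \<partial>out_dist \<sigma> n a)
    = (\<Sum>t<n. \<integral>y. ln (normal_density (a t) \<sigma> (y t)) \<partial>out_dist \<sigma> n a)"
    unfolding ln_gauss[OF assms]
    by (rule Bochner_Integration.integral_sum)
       (subst out_dist_component_integral(2), use assms normal_ln_normal(1) in auto)
  also have "\<dots> = (\<Sum>t<n. - (ln (sqrt (2 * pi) * \<sigma>) + 1 / 2))"
    by (intro sum.cong refl, subst out_dist_component_integral(1))
       (use assms normal_ln_normal(2) in auto)
  also have "\<dots> = - real n * (ln (sqrt (2 * pi) * \<sigma>) + 1 / 2)" by (simp add: algebra_simps)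
  finally show ?thesis .
qed

section \<open>Mixtures of Gaussian product laws\<close>

lemma sigma_finite_lborel_pow: "sigma_finite_measure (lborel_pow n)"
proof -
  interpret product_sigma_finite "\<lambda>_::nat. lborel :: real measure" by (rule product_lborel)
  show ?thesis by (rule sigma_finite) simp
qed

lemma gauss_integral:
  fixes f :: "(nat \<Rightarrow> real) \<Rightarrow> real"
  assumes "\<sigma> > 0" and "f \<in> borel_measurable (lborel_pow n)"
  shows "integrable (lborel_pow n) (\<lambda>y. gauss \<sigma> n a y * f y) \<longleftrightarrow> integrable (out_dist \<sigma> n a) f"
    and "(\<integral>y. gauss \<sigma> n a y * f y \<partial>lborel_pow n) = (\<integral>y. f y \<partial>out_dist \<sigma> n a)"
  unfolding out_dist_density[OF assms(1)]
  using assms gauss_pos[OF assms(1)]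
  by (auto simp: integrable_density integral_density less_imp_le)

text \<open>Output density when the message is uniform on {1..M} and codeword \<open>c m\<close> is
  sent through Gaussian noise.\<close>

definition mix :: "real \<Rightarrow> nat \<Rightarrow> nat \<Rightarrow> (nat \<Rightarrow> nat \<Rightarrow> real) \<Rightarrow> (nat \<Rightarrow> real) \<Rightarrow> real" where
  "mix \<sigma> n M c y = (\<Sum>m\<in>{1..M}. gauss \<sigma> n (c m) y) / M"

lemma mix_measurable [measurable]: "mix \<sigma> n M c \<in> borel_measurable (lborel_pow n)"
  unfolding mix_def[abs_def] by measurable

lemma mix_pos: "\<sigma> > 0 \<Longrightarrow> M > 0 \<Longrightarrow> mix \<sigma> n M c y > 0"
  unfolding mix_def by (intro divide_pos_pos sum_pos) (auto simp: gauss_pos)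

text \<open>An average lies between the smallest and the largest of its terms, so its logarithm lies
  between two of their logarithms. Integrability for mixtures thus reduces to single
  Gaussians.\<close>

lemma abs_ln_mix_le:
  assumes "\<sigma> > 0" "M > 0"
  shows "\<bar>ln (mix \<sigma> n M c y)\<bar> \<le> (\<Sum>m\<in>{1..M}. \<bar>ln (gauss \<sigma> n (c m) y)\<bar>)"
proof -
  let ?g = "\<lambda>m. gauss \<sigma> n (c m) y" and ?x = "mix \<sigma> n M c y"
  have eq: "(\<Sum>m\<in>{1..M}. ?g m) = (\<Sum>m\<in>{1..M}. ?x)" using assms by (simp add: mix_def)
  have ne: "{1..M} \<noteq> {}" using assms by simp
  have bound: "\<bar>ln (?g m)\<bar> \<le> (\<Sum>m\<in>{1..M}. \<bar>ln (?g m)\<bar>)" if "m \<in> {1..M}" for m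
    by (rule member_le_sum[OF that]) auto
  have "\<exists>m\<in>{1..M}. ?x \<le> ?g m"
  proof (rule ccontr)
    assume "\<not> ?thesis"
    then have "(\<Sum>m\<in>{1..M}. ?g m) < (\<Sum>m\<in>{1..M}. ?x)"
      by (intro sum_strict_mono) (use ne in \<open>auto simp: not_le\<close>)
    then show False using eq by simp
  qed
  then obtain m where m: "m \<in> {1..M}" "ln ?x \<le> ln (?g m)"
    using mix_pos[OF assms] gauss_pos[OF assms(1)] by auto
  have "\<exists>m\<in>{1..M}. ?g m \<le> ?x"
  proof (rule ccontr)
    assume "\<not> ?thesis"
    then have "(\<Sum>m\<in>{1..M}. ?x) < (\<Sum>m\<in>{1..M}. ?g m)"
      by (intro sum_strict_mono) (use ne in \<open>auto simp: not_le\<close>)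
    then show False using eq by simp
  qed
  then obtain m' where m': "m' \<in> {1..M}" "ln (?g m') \<le> ln ?x"
    using mix_pos[OF assms] gauss_pos[OF assms(1)] by auto
  show ?thesis using m(2) m'(2) bound[OF m(1)] bound[OF m'(1)] by linarith
qed

lemma integrable_ln_mix:
  assumes "\<sigma> > 0" "M > 0"
  shows "integrable (out_dist \<sigma> n b) (\<lambda>y. ln (mix \<sigma> n M c y))"
proof (rule Bochner_Integration.integrable_bound)
  show "integrable (out_dist \<sigma> n b) (\<lambda>y. \<Sum>m\<in>{1..M}. \<bar>ln (gauss \<sigma> n (c m) y)\<bar>)"
    by (intro Bochner_Integration.integrable_sum integrable_abs integrable_ln_gauss assms)
qed (use abs_ln_mix_le[OF assms] in auto)

lemma integral_mix:
  assumes "\<sigma> > 0" "M > 0"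
  shows "(\<integral>\<^sup>+y. mix \<sigma> n M c y \<partial>lborel_pow n) = 1"
proof -
  interpret prob_space "out_dist \<sigma> n a" for a by (rule prob_space_out_dist[OF assms(1)])
  have 1: "integrable (lborel_pow n) (gauss \<sigma> n a)" "(\<integral>y. gauss \<sigma> n a y \<partial>lborel_pow n) = 1" for a
    using gauss_integral[OF assms(1), of "\<lambda>_. 1" n a] prob_space[of a] by auto
  have "integrable (lborel_pow n) (mix \<sigma> n M c)" "(\<integral>y. mix \<sigma> n M c y \<partial>lborel_pow n) = 1"
    unfolding mix_def using 1 assms by (auto simp: Bochner_Integration.integral_sum)
  then show ?thesis
    by (subst nn_integral_eq_integral) (auto intro: less_imp_le mix_pos assms)
qed

text \<open>Translation invariance of differential entropy. It makes the output law given the own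
  codeword contribute the same entropy whichever own codeword is sent.\<close>

lemma integral_ln_mix_shift:
  assumes "\<sigma> > 0" "M > 0"
  shows "(\<integral>y. ln (mix \<sigma> n M (\<lambda>m t. c m t + d t) y) \<partial>out_dist \<sigma> n (\<lambda>t. a t + d t))
    = (\<integral>y. ln (mix \<sigma> n M c y) \<partial>out_dist \<sigma> n a)"
proof -
  have "gauss \<sigma> n (\<lambda>t. c m t + d t) (\<lambda>t\<in>{..<n}. y t + d t) = gauss \<sigma> n (c m) y" for m y
    unfolding gauss_def by (rule prod.cong) (auto simp: normal_density_def)
  then have "mix \<sigma> n M (\<lambda>m t. c m t + d t) (\<lambda>t\<in>{..<n}. y t + d t) = mix \<sigma> n M c y" for y
    by (simp add: mix_def)
  then show ?thesis
    by (subst integral_out_dist_shift[OF assms(1)]) auto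
qed

text \<open>Differential entropy in nats of the density \<open>mix \<sigma> n M c\<close>: the
  integral of - mix ln mix, expanded over its M equally likely Gaussian components.\<close>

definition output_entropy :: "real \<Rightarrow> nat \<Rightarrow> nat \<Rightarrow> (nat \<Rightarrow> nat \<Rightarrow> real) \<Rightarrow> real" where
  "output_entropy \<sigma> n M c = - (\<Sum>m\<in>{1..M}. \<integral>y. ln (mix \<sigma> n M c y) \<partial>out_dist \<sigma> n (c m)) / M"

section \<open>Joint law of the channel output and the genie signal\<close>

lemma pair_out_dist_density:
  assumes "\<sigma> > 0"
  shows "out_dist \<sigma> n a \<Otimes>\<^sub>M out_dist \<sigma> n b = density (lborel_pow n \<Otimes>\<^sub>M lborel_pow n)
    (\<lambda>z. ennreal (gauss \<sigma> n a (fst z) * gauss \<sigma> n b (snd z)))"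
proof -
  have "out_dist \<sigma> n a \<Otimes>\<^sub>M out_dist \<sigma> n b = density (lborel_pow n \<Otimes>\<^sub>M lborel_pow n)
    (\<lambda>(y, s). ennreal (gauss \<sigma> n a y) * ennreal (gauss \<sigma> n b s))"
    unfolding out_dist_density[OF assms]
  proof (rule pair_measure_density)
    show "sigma_finite_measure (density (lborel_pow n) (gauss \<sigma> n b))"
      unfolding out_dist_density[OF assms, symmetric]
      by (rule prob_space_imp_sigma_finite[OF prob_space_out_dist[OF assms]])
  qed (auto intro: sigma_finite_lborel_pow)
  also have "(\<lambda>(y, s). ennreal (gauss \<sigma> n a y) * ennreal (gauss \<sigma> n b s))
    = (\<lambda>z. ennreal (gauss \<sigma> n a (fst z) * gauss \<sigma> n b (snd z)))"
    using gauss_pos[OF assms] by (auto simp: fun_eq_iff ennreal_mult less_imp_le)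
  finally show ?thesis .
qed

text \<open>The weight is the density of the pair (Y, S) for a fixed own message: Y is averaged over
  the interferer's codewords, while S does not involve them. Expectations reduce to averages over
  product laws.\<close>

lemma mix_gauss_integral:
  fixes F :: "(nat \<Rightarrow> real) \<times> (nat \<Rightarrow> real) \<Rightarrow> real"
  assumes "\<sigma> > 0" and F: "F \<in> borel_measurable (lborel_pow n \<Otimes>\<^sub>M lborel_pow n)"
    and int: "\<And>j. j \<in> {1..M} \<Longrightarrow> integrable (out_dist \<sigma> n (a j) \<Otimes>\<^sub>M out_dist \<sigma> n b) F"
  shows "integrable (lborel_pow n \<Otimes>\<^sub>M lborel_pow n) (\<lambda>z. mix \<sigma> n M a (fst z) * gauss \<sigma> n b (snd z) * F z)"
    and "(\<integral>z. mix \<sigma> n M a (fst z) * gauss \<sigma> n b (snd z) * F z \<partial>(lborel_pow n \<Otimes>\<^sub>M lborel_pow n))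
      = (\<Sum>j\<in>{1..M}. \<integral>z. F z \<partial>(out_dist \<sigma> n (a j) \<Otimes>\<^sub>M out_dist \<sigma> n b)) / M"
proof -
  let ?L = "lborel_pow n \<Otimes>\<^sub>M lborel_pow n"
  have g: "integrable ?L (\<lambda>z. gauss \<sigma> n (a j) (fst z) * gauss \<sigma> n b (snd z) * F z)"
    "(\<integral>z. gauss \<sigma> n (a j) (fst z) * gauss \<sigma> n b (snd z) * F z \<partial>?L)
      = (\<integral>z. F z \<partial>(out_dist \<sigma> n (a j) \<Otimes>\<^sub>M out_dist \<sigma> n b))" if "j \<in> {1..M}" for j
    using int[OF that] F gauss_pos[OF assms(1)] unfolding pair_out_dist_density[OF assms(1)]
    by (auto simp: integrable_density integral_density less_imp_le)
  have eq: "mix \<sigma> n M a (fst z) * gauss \<sigma> n b (snd z) * F z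
    = (\<Sum>j\<in>{1..M}. gauss \<sigma> n (a j) (fst z) * gauss \<sigma> n b (snd z) * F z) / M" for z
    by (simp add: mix_def sum_distrib_right)
  show "integrable ?L (\<lambda>z. mix \<sigma> n M a (fst z) * gauss \<sigma> n b (snd z) * F z)"
    unfolding eq using g(1) by (intro integrable_divide Bochner_Integration.integrable_sum) auto
  show "(\<integral>z. mix \<sigma> n M a (fst z) * gauss \<sigma> n b (snd z) * F z \<partial>?L)
      = (\<Sum>j\<in>{1..M}. \<integral>z. F z \<partial>(out_dist \<sigma> n (a j) \<Otimes>\<^sub>M out_dist \<sigma> n b)) / M"
    unfolding eq using g by (simp add: Bochner_Integration.integral_sum)
qed

lemma (in prob_space) distr_pair_snd:
  assumes "prob_space N"
  shows "distr (M \<Otimes>\<^sub>M N) N snd = N"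
proof (rule measure_eqI)
  interpret N: prob_space N by fact
  fix X assume X: "X \<in> sets (distr (M \<Otimes>\<^sub>M N) N snd)"
  then have "snd -` X \<inter> space (M \<Otimes>\<^sub>M N) = space M \<times> X"
    using sets.sets_into_space[of X N] by (auto simp: space_pair_measure)
  then show "emeasure (distr (M \<Otimes>\<^sub>M N) N snd) X = emeasure N X"
    using X by (simp add: emeasure_distr N.emeasure_pair_measure_Times emeasure_space_1)
qed simp

lemma pair_marginal_integral:
  fixes f :: "(nat \<Rightarrow> real) \<Rightarrow> real"
  assumes "\<sigma> > 0" and [measurable]: "f \<in> borel_measurable (lborel_pow n)"
  shows "(\<integral>z. f (fst z) \<partial>(out_dist \<sigma> n a \<Otimes>\<^sub>M out_dist \<sigma> n b)) = (\<integral>y. f y \<partial>out_dist \<sigma> n a)"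
    and "integrable (out_dist \<sigma> n a) f \<Longrightarrow> integrable (out_dist \<sigma> n a \<Otimes>\<^sub>M out_dist \<sigma> n b) (\<lambda>z. f (fst z))"
    and "(\<integral>z. f (snd z) \<partial>(out_dist \<sigma> n a \<Otimes>\<^sub>M out_dist \<sigma> n b)) = (\<integral>y. f y \<partial>out_dist \<sigma> n b)"
    and "integrable (out_dist \<sigma> n b) f \<Longrightarrow> integrable (out_dist \<sigma> n a \<Otimes>\<^sub>M out_dist \<sigma> n b) (\<lambda>z. f (snd z))"
proof -
  interpret a: prob_space "out_dist \<sigma> n a" by (rule prob_space_out_dist[OF assms(1)])
  interpret b: prob_space "out_dist \<sigma> n b" by (rule prob_space_out_dist[OF assms(1)])
  interpret pair_prob_space "out_dist \<sigma> n a" "out_dist \<sigma> n b" ..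
  let ?P = "out_dist \<sigma> n a \<Otimes>\<^sub>M out_dist \<sigma> n b"
  have 1: "distr ?P (out_dist \<sigma> n a) fst = out_dist \<sigma> n a" by (rule b.distr_pair_fst)
  have 2: "distr ?P (out_dist \<sigma> n b) snd = out_dist \<sigma> n b" by (rule a.distr_pair_snd) unfold_locales
  have [measurable]: "f \<in> borel_measurable (out_dist \<sigma> n c)" for c by measurable
  show "(\<integral>z. f (fst z) \<partial>?P) = (\<integral>y. f y \<partial>out_dist \<sigma> n a)"
    by (subst (2) 1[symmetric], subst integral_distr) auto
  show "(\<integral>z. f (snd z) \<partial>?P) = (\<integral>y. f y \<partial>out_dist \<sigma> n b)"
    by (subst (2) 2[symmetric], subst integral_distr) auto
  show "integrable (out_dist \<sigma> n a) f \<Longrightarrow> integrable ?P (\<lambda>z. f (fst z))"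
    by (subst (asm) 1[symmetric], subst (asm) integrable_distr_eq) auto
  show "integrable (out_dist \<sigma> n b) f \<Longrightarrow> integrable ?P (\<lambda>z. f (snd z))"
    by (subst (asm) 2[symmetric], subst (asm) integrable_distr_eq) auto
qed

lemma indep_var_fst_snd:
  assumes "prob_space M" "prob_space N"
  shows "prob_space.indep_var (M \<Otimes>\<^sub>M N) M fst N snd"
proof -
  interpret M: prob_space M by fact
  interpret N: prob_space N by fact
  interpret pair_prob_space M N ..
  have 2: "distr (M \<Otimes>\<^sub>M N) N snd = N" by (rule M.distr_pair_snd[OF assms(2)])
  show ?thesis
    by (subst P.indep_var_distribution_eq) (auto simp: N.distr_pair_fst 2 distr_id2)
qed

text \<open>With independent noises the residual k (Y - c S) has variance k^2 (1 + c^2) \<sigma>^2.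
  The condition on k makes this \<sigma>^2, the noise level at which the kernel is
  available.\<close>

lemma genie_residual_normal:
  fixes k c :: real
  assumes "\<sigma> > 0" "c > 0" "t < n" and k: "k > 0" "k\<^sup>2 * (1 + c\<^sup>2) = 1"
  shows "distributed (out_dist \<sigma> n a \<Otimes>\<^sub>M out_dist \<sigma> n b) lborel
    (\<lambda>z. k * (fst z t - c * snd z t)) (normal_density (k * (a t - c * b t)) \<sigma>)"
proof -
  interpret a: prob_space "out_dist \<sigma> n a" by (rule prob_space_out_dist[OF assms(1)])
  interpret b: prob_space "out_dist \<sigma> n b" by (rule prob_space_out_dist[OF assms(1)])
  interpret pair_prob_space "out_dist \<sigma> n a" "out_dist \<sigma> n b" ..
  let ?P = "out_dist \<sigma> n a \<Otimes>\<^sub>M out_dist \<sigma> n b"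
  have ind: "P.indep_var (out_dist \<sigma> n a) fst (out_dist \<sigma> n b) snd"
    by (rule indep_var_fst_snd) unfold_locales
  have proj: "(\<lambda>y. r * y t) \<in> borel_measurable (lborel_pow n)" for r :: real
    using measurable_component_singleton[of t "{..<n}" "\<lambda>_. lborel :: real measure"] assms(3) by simp
  have "P.indep_var borel ((\<lambda>y. k * y t) \<circ> fst) borel ((\<lambda>y. k * c * y t) \<circ> snd)"
    by (rule P.indep_var_compose[OF ind]) (use proj in \<open>auto simp: measurable_cong_sets[OF sets_out_dist refl]\<close>)
  then have ind': "P.indep_var borel (\<lambda>z. k * fst z t) borel (\<lambda>z. k * c * snd z t)"
    by (simp add: comp_def)
  have 1: "distributed ?P lborel (\<lambda>z. fst z t) (normal_density (a t) \<sigma>)"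
    using out_dist_component[OF assms(1,3), of a] b.distr_pair_fst[of "out_dist \<sigma> n a"]
      distr_distr[of "\<lambda>y. y t" "out_dist \<sigma> n a" lborel fst ?P] assms(3)
    by (simp add: distributed_def comp_def)
  have 2: "distributed ?P lborel (\<lambda>z. snd z t) (normal_density (b t) \<sigma>)"
    using out_dist_component[OF assms(1,3), of b] a.distr_pair_snd[OF b.prob_space_axioms]
      distr_distr[of "\<lambda>y. y t" "out_dist \<sigma> n b" lborel snd ?P] assms(3)
    by (simp add: distributed_def comp_def)
  have n1: "distributed ?P lborel (\<lambda>z. k * fst z t) (normal_density (k * a t) (k * \<sigma>))"
    using P.normal_density_affine[OF 1 assms(1), of k 0] k by simp
  have n2: "distributed ?P lborel (\<lambda>z. k * c * snd z t) (normal_density (k * c * b t) (k * c * \<sigma>))"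
    using P.normal_density_affine[OF 2 assms(1), of "k * c" 0] k assms(2) by simp
  have "distributed ?P lborel (\<lambda>z. k * fst z t - k * c * snd z t)
      (normal_density (k * a t - k * c * b t) (sqrt ((k * \<sigma>)\<^sup>2 + (k * c * \<sigma>)\<^sup>2)))"
    by (rule P.diff_indep_normal[OF ind' _ _ n1 n2]) (use assms in auto)
  moreover have "sqrt ((k * \<sigma>)\<^sup>2 + (k * c * \<sigma>)\<^sup>2) = \<sigma>"
  proof -
    have "(k * \<sigma>)\<^sup>2 + (k * c * \<sigma>)\<^sup>2 = (k\<^sup>2 * (1 + c\<^sup>2)) * \<sigma>\<^sup>2"
      by (simp add: power_mult_distrib algebra_simps)
    then show ?thesis using k assms(1) by simp
  qed
  ultimately show ?thesis by (simp add: right_diff_distrib mult.assoc)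
qed

section \<open>Converse for a fixed interferer\<close>

lemma nn_integral_prod_density:
  assumes [measurable]: "\<And>t. f t \<in> borel_measurable borel"
    and "\<And>t x. 0 \<le> f t x" and "\<And>t. t < n \<Longrightarrow> (\<integral>\<^sup>+x. ennreal (f t x) \<partial>lborel) = 1"
  shows "(\<integral>\<^sup>+y. ennreal (\<Prod>t<n. f t (y t)) \<partial>lborel_pow n) = 1"
proof -
  interpret product_sigma_finite "\<lambda>_::nat. lborel :: real measure" by (rule product_lborel)
  have "(\<integral>\<^sup>+y. ennreal (\<Prod>t<n. f t (y t)) \<partial>lborel_pow n)
    = (\<integral>\<^sup>+y. (\<Prod>t<n. ennreal (f t (y t))) \<partial>lborel_pow n)"
    using assms(2) by (simp add: prod_ennreal)
  also have "\<dots> = (\<Prod>t<n. \<integral>\<^sup>+x. ennreal (f t x) \<partial>lborel)"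
    by (rule product_nn_integral_prod) auto
  finally show ?thesis using assms(3) by simp
qed

text \<open>An affine change of variable. The single-user bound takes k = 1 and v the interfering
  letter; the genie bound takes v = c s_t, where s_t is the genie letter.\<close>

lemma nn_integral_affine_density:
  fixes R :: "real \<Rightarrow> real"
  assumes [measurable]: "R \<in> borel_measurable borel" and "\<And>y. R y > 0"
    and "integrable lborel R" "(\<integral>y. R y \<partial>lborel) = 1" and "k > 0"
  shows "(\<integral>\<^sup>+x. ennreal (k * R (k * (x - v))) \<partial>lborel) = 1"
proof -
  have "1 = (\<integral>\<^sup>+x. ennreal (R x) \<partial>lborel)"
    using assms by (subst nn_integral_eq_integral) (auto intro: less_imp_le)
  also have "(\<integral>\<^sup>+x. ennreal (R x) \<partial>lborel) = \<bar>k\<bar> * (\<integral>\<^sup>+x. ennreal (R (- k * v + k * x)) \<partial>lborel)"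
    using assms by (intro nn_integral_real_affine) auto
  also have "\<dots> = (\<integral>\<^sup>+x. ennreal k * ennreal (R (- k * v + k * x)) \<partial>lborel)"
    using assms(5) by (subst nn_integral_cmult) auto
  also have "\<dots> = (\<integral>\<^sup>+x. ennreal (k * R (k * (x - v))) \<partial>lborel)"
    using assms(2,5) by (intro nn_integral_cong) (simp add: ennreal_mult less_imp_le algebra_simps)
  finally show ?thesis by (rule sym)
qed

lemma output_kernelD:
  assumes "output_kernel \<sigma> A \<alpha> C R"
  shows "R \<in> borel_measurable borel" "R y > 0" "integrable lborel R" "(\<integral>y. R y \<partial>lborel) = 1"
    "\<exists>a b. \<forall>y. \<bar>ln (R y)\<bar> \<le> a + b * y\<^sup>2"
  using assms unfolding output_kernel_def by blast+

lemma output_kernel_sum: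
  fixes x :: "nat \<times> nat \<Rightarrow> real"
  assumes "output_kernel \<sigma> A \<alpha> C R" "finite I" "\<forall>i\<in>I. 0 \<le> x i \<and> x i \<le> A"
    "(\<Sum>i\<in>I. x i) \<le> real (card I) * (\<alpha> * A)"
  shows "(\<Sum>i\<in>I. \<integral>y. normal_density (x i) \<sigma> y * (- ln (R y)) \<partial>lborel)
          \<le> real (card I) * (ln (sqrt (2 * pi) * \<sigma>) + 1 / 2 + C)"
  by (rule assms(1)[unfolded output_kernel_def, THEN conjunct2, THEN conjunct2, THEN conjunct2,
      THEN conjunct2, THEN conjunct2, rule_format, OF assms(2) bspec[OF assms(3)] assms(4)])

text \<open>The kernel is applied once to all letters of all codewords: each codeword obeys the
  constraint in time average, hence the whole codebook obeys it on average.\<close>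

lemma output_kernel_codebook:
  assumes "output_kernel \<sigma> A \<alpha> C R" and "\<And>m. m \<in> {1..M} \<Longrightarrow> valid_codeword A \<alpha> n (x m)"
  shows "(\<Sum>m\<in>{1..M}. \<Sum>t<n. \<integral>y. normal_density (x m t) \<sigma> y * (- ln (R y)) \<partial>lborel)
    \<le> real M * (real n * (ln (sqrt (2 * pi) * \<sigma>) + 1 / 2 + C))"
proof -
  let ?I = "{1..M} \<times> {..<n}" and ?x = "\<lambda>i. x (fst i) (snd i)"
  have "(\<Sum>i\<in>?I. \<integral>y. normal_density (?x i) \<sigma> y * (- ln (R y)) \<partial>lborel)
    \<le> real (card ?I) * (ln (sqrt (2 * pi) * \<sigma>) + 1 / 2 + C)"
  proof -
    have "(\<Sum>i\<in>?I. ?x i) = (\<Sum>m\<in>{1..M}. \<Sum>t<n. x m t)"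
      by (simp add: sum.cartesian_product case_prod_beta)
    also have "\<dots> \<le> (\<Sum>m\<in>{1..M}. real n * (\<alpha> * A))"
      using assms(2) by (intro sum_mono) (auto simp: valid_codeword_def)
    finally have "(\<Sum>i\<in>?I. ?x i) \<le> real (card ?I) * (\<alpha> * A)" by simp
    then show ?thesis
      by (intro output_kernel_sum[OF assms(1)]) (use assms(2) in \<open>auto simp: valid_codeword_def\<close>)
  qed
  then show ?thesis by (simp add: sum.cartesian_product case_prod_beta mult.assoc)
qed

lemma indicator_integral_out_dist:
  assumes "\<sigma> > 0" and "g \<in> PiM {..<n} (\<lambda>_. borel) \<rightarrow>\<^sub>M count_space UNIV"
  shows "{y \<in> space (lborel_pow n). g y = m} \<in> sets (lborel_pow n)"
    and "(\<integral>y. indicator {y \<in> space (lborel_pow n). g y = m} y \<partial>out_dist \<sigma> n a)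
      = 1 - measure (out_dist \<sigma> n a) {y \<in> space (out_dist \<sigma> n a). g y \<noteq> m}"
proof -
  interpret prob_space "out_dist \<sigma> n a" by (rule prob_space_out_dist[OF assms(1)])
  have "sets (lborel_pow n) = sets (PiM {..<n} (\<lambda>_. borel))" by (intro sets_PiM_cong) auto
  then have [measurable]: "g \<in> lborel_pow n \<rightarrow>\<^sub>M count_space UNIV"
    using assms(2) by (simp add: measurable_cong_sets)
  show D: "{y \<in> space (lborel_pow n). g y = m} \<in> sets (lborel_pow n)" by measurable
  have "space (out_dist \<sigma> n a) - {y \<in> space (out_dist \<sigma> n a). g y = m}
    = {y \<in> space (out_dist \<sigma> n a). g y \<noteq> m}" by auto
  then show "(\<integral>y. indicator {y \<in> space (lborel_pow n). g y = m} y \<partial>out_dist \<sigma> n a)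
      = 1 - measure (out_dist \<sigma> n a) {y \<in> space (out_dist \<sigma> n a). g y \<noteq> m}"
    using prob_compl[of "{y \<in> space (out_dist \<sigma> n a). g y = m}"] D by simp
qed

lemma single_user_converse:
  fixes v :: "nat \<Rightarrow> real" and x :: "nat \<Rightarrow> nat \<Rightarrow> real"
  assumes "\<sigma> > 0" "M > 0" and K: "output_kernel \<sigma> A \<alpha> C R"
    and x: "\<And>m. m \<in> {1..M} \<Longrightarrow> valid_codeword A \<alpha> n (x m)"
    and g: "g \<in> PiM {..<n} (\<lambda>_. borel) \<rightarrow>\<^sub>M count_space UNIV"
  defines "N \<equiv> \<lambda>m. out_dist \<sigma> n (\<lambda>t. x m t + v t)"
  shows "ln M * (\<Sum>m\<in>{1..M}. 1 - measure (N m) {y \<in> space (N m). g y \<noteq> m}) - M \<le> real M * (real n * C)"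
proof -
  note [measurable] = output_kernelD(1)[OF K]
  define a where "a = (\<lambda>m t. x m t + v t)"
  \<comment> \<open>The interfering codeword is treated as known. Recentring the reference density
    at it removes v from every relative entropy.\<close>
  define q where "q = (\<lambda>y. \<Prod>t<n. R (y t - v t))"
  have qm[measurable]: "q \<in> borel_measurable (lborel_pow n)" unfolding q_def by measurable
  have q_pos: "q y > 0" for y unfolding q_def by (intro prod_pos) (simp add: output_kernelD(2)[OF K])
  have "(\<integral>\<^sup>+y. ennreal (q y) \<partial>lborel_pow n) = ennreal 1"
    unfolding q_def using nn_integral_affine_density[OF output_kernelD(1-4)[OF K], of 1]
    by (subst nn_integral_prod_density) (auto intro: less_imp_le output_kernelD(2)[OF K])
  then have q_int: "integrable (lborel_pow n) q" "(\<integral>y. q y \<partial>lborel_pow n) = 1"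
    using nn_integral_eq_integrable[of q "lborel_pow n" 1] q_pos by (auto intro: less_imp_le)
  have ln_q: "ln (q y) = (\<Sum>t<n. ln (R (y t - v t)))" for y
    unfolding q_def using output_kernelD(2)[OF K] by (intro ln_prod) (auto simp: less_le)
  obtain b c where "\<And>y. \<bar>ln (R y)\<bar> \<le> b + c * y\<^sup>2" using output_kernelD(5)[OF K] by blast
  note intR = integrable_normal_ln[OF assms(1) output_kernelD(1)[OF K] this]
  have shift: "integrable lborel (\<lambda>y. normal_density (u + w) \<sigma> y * ln (R (y - w)))"
    "(\<integral>y. normal_density (u + w) \<sigma> y * ln (R (y - w)) \<partial>lborel)
      = (\<integral>y. normal_density u \<sigma> y * ln (R y) \<partial>lborel)" for u w
  proof -
    have *: "normal_density (u + w) \<sigma> (w + y) = normal_density u \<sigma> y" for y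
      by (simp add: normal_density_def)
    show "integrable lborel (\<lambda>y. normal_density (u + w) \<sigma> y * ln (R (y - w)))"
      using intR[of u]
      by (subst lborel_integrable_real_affine_iff[where c=1 and t=w, symmetric]) (simp_all add: *)
    show "(\<integral>y. normal_density (u + w) \<sigma> y * ln (R (y - w)) \<partial>lborel)
      = (\<integral>y. normal_density u \<sigma> y * ln (R y) \<partial>lborel)"
      by (subst lborel_integral_real_affine[where c=1 and t=w]) (simp_all add: *)
  qed
  have int_q: "integrable (out_dist \<sigma> n (a m)) (\<lambda>y. ln (q y))" for m
    unfolding ln_q
    by (intro Bochner_Integration.integrable_sum, subst out_dist_component_integral(2))
       (use shift(1) assms(1) in \<open>auto simp: a_def\<close>)
  have val_q: "(\<integral>y. ln (q y) \<partial>out_dist \<sigma> n (a m))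
    = (\<Sum>t<n. \<integral>y. normal_density (x m t) \<sigma> y * ln (R y) \<partial>lborel)" for m
  proof -
    have "(\<integral>y. ln (q y) \<partial>out_dist \<sigma> n (a m)) = (\<Sum>t<n. \<integral>y. ln (R (y t - v t)) \<partial>out_dist \<sigma> n (a m))"
      unfolding ln_q
      by (intro Bochner_Integration.integral_sum, subst out_dist_component_integral(2))
         (use shift(1) assms(1) in \<open>auto simp: a_def\<close>)
    also have "\<dots> = (\<Sum>t<n. \<integral>y. normal_density (x m t) \<sigma> y * ln (R y) \<partial>lborel)"
      by (intro sum.cong refl, subst out_dist_component_integral(1))
         (use shift(2) assms(1) in \<open>auto simp: a_def\<close>)
    finally show ?thesis .
  qed
  have F: "integrable (out_dist \<sigma> n (a m)) (\<lambda>y. ln (gauss \<sigma> n (a m) y) - ln (q y))" for m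
    using int_q integrable_ln_gauss[OF assms(1)] by auto
  let ?D = "\<lambda>m. {y \<in> space (lborel_pow n). g y = m}"
  have gm: "?D m \<in> sets (lborel_pow n)" for m by (rule indicator_integral_out_dist(1)[OF assms(1) g])
  interpret prob_space "out_dist \<sigma> n u" for u by (rule prob_space_out_dist[OF assms(1)])
  have "ln M * (\<Sum>m\<in>{1..M}. \<integral>y. indicator (?D m) y * gauss \<sigma> n (a m) y \<partial>lborel_pow n) - M
    \<le> (\<Sum>m\<in>{1..M}. \<integral>y. gauss \<sigma> n (a m) y * (ln (gauss \<sigma> n (a m) y) - ln (q y)) \<partial>lborel_pow n)"
  proof (rule decoder_converse[OF assms(2)])
    fix m
    show "integrable (lborel_pow n) (gauss \<sigma> n (a m))" "(\<integral>y. gauss \<sigma> n (a m) y \<partial>lborel_pow n) = 1"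
      using gauss_integral[OF assms(1), of "\<lambda>_. 1" n "a m"] prob_space by auto
    show "integrable (lborel_pow n) (\<lambda>y. gauss \<sigma> n (a m) y * (ln (gauss \<sigma> n (a m) y) - ln (q y)))"
      using F by (subst gauss_integral(1)[OF assms(1)]) auto
  qed (use q_int q_pos gauss_pos[OF assms(1)] gm in auto)
  \<comment> \<open>Relative entropy is cross entropy minus the entropy of the noise. The latter is
    the constant that \<open>output_kernel\<close> adds to C, so it cancels below.\<close>
  also have "\<dots> = (\<Sum>m\<in>{1..M}. - real n * (ln (sqrt (2 * pi) * \<sigma>) + 1 / 2)
      + (\<Sum>t<n. \<integral>y. normal_density (x m t) \<sigma> y * (- ln (R y)) \<partial>lborel))"
  proof (intro sum.cong refl)
    fix m
    have "(\<integral>y. gauss \<sigma> n (a m) y * (ln (gauss \<sigma> n (a m) y) - ln (q y)) \<partial>lborel_pow n)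
      = (\<integral>y. ln (gauss \<sigma> n (a m) y) - ln (q y) \<partial>out_dist \<sigma> n (a m))"
      by (rule gauss_integral(2)[OF assms(1)]) measurable
    also have "\<dots> = (\<integral>y. ln (gauss \<sigma> n (a m) y) \<partial>out_dist \<sigma> n (a m)) - (\<integral>y. ln (q y) \<partial>out_dist \<sigma> n (a m))"
      by (rule Bochner_Integration.integral_diff[OF integrable_ln_gauss[OF assms(1)] int_q])
    finally show "(\<integral>y. gauss \<sigma> n (a m) y * (ln (gauss \<sigma> n (a m) y) - ln (q y)) \<partial>lborel_pow n)
      = - real n * (ln (sqrt (2 * pi) * \<sigma>) + 1 / 2)
      + (\<Sum>t<n. \<integral>y. normal_density (x m t) \<sigma> y * (- ln (R y)) \<partial>lborel)"
      by (simp add: integral_ln_gauss[OF assms(1)] val_q sum_negf)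
  qed
  also have "\<dots> = - real M * real n * (ln (sqrt (2 * pi) * \<sigma>) + 1 / 2)
      + (\<Sum>m\<in>{1..M}. \<Sum>t<n. \<integral>y. normal_density (x m t) \<sigma> y * (- ln (R y)) \<partial>lborel)"
    unfolding sum.distrib by simp
  also have "\<dots> \<le> - real M * real n * (ln (sqrt (2 * pi) * \<sigma>) + 1 / 2)
    + real M * (real n * (ln (sqrt (2 * pi) * \<sigma>) + 1 / 2 + C))"
    by (rule add_left_mono, rule output_kernel_codebook[OF K], rule x)
  also have "\<dots> = real M * (real n * C)" by (simp add: algebra_simps)
  finally have main: "ln M * (\<Sum>m\<in>{1..M}. \<integral>y. indicator (?D m) y * gauss \<sigma> n (a m) y \<partial>lborel_pow n) - M
    \<le> real M * (real n * C)" .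
  have success: "(\<Sum>m\<in>{1..M}. \<integral>y. indicator (?D m) y * gauss \<sigma> n (a m) y \<partial>lborel_pow n)
    = (\<Sum>m\<in>{1..M}. 1 - measure (N m) {y \<in> space (N m). g y \<noteq> m})"
  proof (intro sum.cong refl)
    fix m
    have "(\<integral>y. indicator (?D m) y * gauss \<sigma> n (a m) y \<partial>lborel_pow n)
      = (\<integral>y. indicator (?D m) y \<partial>out_dist \<sigma> n (a m))"
      using gm by (subst gauss_integral(2)[OF assms(1), symmetric]) (simp_all add: mult.commute)
    moreover have "N m = out_dist \<sigma> n (a m)" by (simp add: N_def a_def)
    ultimately show "(\<integral>y. indicator (?D m) y * gauss \<sigma> n (a m) y \<partial>lborel_pow n)
      = 1 - measure (N m) {y \<in> space (N m). g y \<noteq> m}"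
      using indicator_integral_out_dist(2)[OF assms(1) g, where m = m and a = "a m"] by presburger
  qed
  show ?thesis using main unfolding success .
qed

section \<open>Converse with a genie\<close>

text \<open>The receiver is given S = hx X + Z with the noise Z of the other receiver. The reference
  density is the law of S times the product density R of the residual Y - (hs / hx) S, which is the
  scaled interference in Gaussian noise; k rescales that noise back to standard deviation sigma.\<close>

lemma genie_converse:
  fixes xa xb :: "nat \<Rightarrow> nat \<Rightarrow> real" and hs hc hx :: real
  assumes "\<sigma> > 0" "Ma > 0" "Mb > 0" "hs > 0" "hx > 0"
  defines "k \<equiv> hx / sqrt (hs\<^sup>2 + hx\<^sup>2)"
  assumes K: "output_kernel \<sigma> A \<alpha> C R"
    and x: "\<And>m. m \<in> {1..Mb} \<Longrightarrow> valid_codeword A \<alpha> n (\<lambda>t. k * hc * xb m t)"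
    and g: "g \<in> PiM {..<n} (\<lambda>_. borel) \<rightarrow>\<^sub>M count_space UNIV"
  defines "N \<equiv> \<lambda>ma mb. out_dist \<sigma> n (\<lambda>t. hs * xa ma t + hc * xb mb t)"
  shows "ln Ma * (\<Sum>ma\<in>{1..Ma}. (\<Sum>mb\<in>{1..Mb}. 1 - measure (N ma mb) {y \<in> space (N ma mb). g y \<noteq> ma}) / Mb) - Ma
    \<le> real Ma * (output_entropy \<sigma> n Ma (\<lambda>m t. hx * xa m t) - output_entropy \<sigma> n Mb (\<lambda>m t. hc * xb m t)
        + real n * (C - ln k))"
proof -
  note [measurable] = output_kernelD(1)[OF K]
  define c where "c = hs / hx"
  have c: "c > 0" using assms by (simp add: c_def)
  have hh: "0 < hs\<^sup>2 + hx\<^sup>2" using assms by (simp add: add_pos_pos)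
  have k: "k > 0" using assms hh by (simp add: k_def)
  have k1: "k\<^sup>2 * (1 + c\<^sup>2) = 1"
    using assms hh by (simp add: k_def c_def power_divide divide_simps)
  let ?c0 = "ln (sqrt (2 * pi) * \<sigma>) + 1 / 2"
  let ?L = "lborel_pow n \<Otimes>\<^sub>M lborel_pow n"
  define a where "a = (\<lambda>ma mb t. hs * xa ma t + hc * xb mb t)"
  define b where "b = (\<lambda>ma t. hx * xa ma t)"
  \<comment> \<open>Y and S get independent noises. The decoding error depends only on the marginal
    law of Y, so this coupling can be chosen.\<close>
  define P where "P = (\<lambda>ma mb. out_dist \<sigma> n (a ma mb) \<Otimes>\<^sub>M out_dist \<sigma> n (b ma))"
  have prob: "prob_space (P ma mb)" for ma mb
    unfolding P_def by (intro prob_space_pair prob_space_out_dist assms(1))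
  have setsP[measurable_cong]: "sets (P ma mb) = sets ?L" for ma mb
    unfolding P_def by (intro sets_pair_measure_cong) auto
  \<comment> \<open>The receiver does not know the interfering message, hence the mixture in Y;
    given the own message, S is a single Gaussian vector.\<close>
  define p where "p = (\<lambda>ma z. mix \<sigma> n Mb (a ma) (fst z) * gauss \<sigma> n (b ma) (snd z))"
  \<comment> \<open>The factor k is the Jacobian of the rescaling, and its logarithm becomes the
    term - ln k of the bound.\<close>
  define r where "r = (\<lambda>z :: (nat \<Rightarrow> real) \<times> (nat \<Rightarrow> real). \<Prod>t<n. k * R (k * (fst z t - c * snd z t)))"
  define q where "q = (\<lambda>z. mix \<sigma> n Ma b (snd z) * r z)"
  have pm[measurable]: "p ma \<in> borel_measurable ?L" for ma unfolding p_def by measurable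
  have comp[measurable]: "(\<lambda>z. fst z t) \<in> borel_measurable ?L" "(\<lambda>z. snd z t) \<in> borel_measurable ?L"
    if "t < n" for t
    using measurable_component_singleton[of t "{..<n}" "\<lambda>_. lborel :: real measure"] that
    by (auto intro: measurable_compose[OF measurable_fst] measurable_compose[OF measurable_snd])
  have rm[measurable]: "r \<in> borel_measurable ?L"
    unfolding r_def by (intro borel_measurable_prod) (use comp in measurable)
  have qm[measurable]: "q \<in> borel_measurable ?L" unfolding q_def by measurable
  have r_pos: "r z > 0" for z
    unfolding r_def by (intro prod_pos) (simp add: output_kernelD(2)[OF K] k)
  have q_pos: "q z > 0" for z unfolding q_def using r_pos mix_pos assms by simp
  have p_pos: "p ma z > 0" for ma z
    unfolding p_def using mix_pos gauss_pos assms by simp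

  have q_int: "integrable ?L q" "(\<integral>z. q z \<partial>?L) = 1"
  proof -
    interpret L: sigma_finite_measure "lborel_pow n" by (rule sigma_finite_lborel_pow)
    interpret LL: pair_sigma_finite "lborel_pow n" "lborel_pow n" ..
    have "(\<integral>\<^sup>+z. ennreal (q z) \<partial>?L) = (\<integral>\<^sup>+s. \<integral>\<^sup>+y. ennreal (q (y, s)) \<partial>lborel_pow n \<partial>lborel_pow n)"
      by (rule LL.nn_integral_snd[symmetric]) measurable
    also have "\<dots> = (\<integral>\<^sup>+s. ennreal (mix \<sigma> n Ma b s) \<partial>lborel_pow n)"
    proof (rule nn_integral_cong)
      fix s assume s: "s \<in> space (lborel_pow n)"
      have r1: "(\<integral>\<^sup>+y. ennreal (r (y, s)) \<partial>lborel_pow n) = 1"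
        unfolding r_def using nn_integral_affine_density[OF output_kernelD(1-4)[OF K] k]
        by (simp, intro nn_integral_prod_density) (auto intro!: mult_nonneg_nonneg less_imp_le[OF output_kernelD(2)[OF K]] less_imp_le[OF k])
      have [measurable]: "(\<lambda>y. r (y, s)) \<in> borel_measurable (lborel_pow n)"
        using s by measurable
      have "(\<integral>\<^sup>+y. ennreal (q (y, s)) \<partial>lborel_pow n)
        = (\<integral>\<^sup>+y. ennreal (mix \<sigma> n Ma b s) * ennreal (r (y, s)) \<partial>lborel_pow n)"
        unfolding q_def using r_pos mix_pos[OF assms(1,2)]
        by (intro nn_integral_cong) (simp add: ennreal_mult less_imp_le)
      also have "\<dots> = ennreal (mix \<sigma> n Ma b s)" by (subst nn_integral_cmult) (simp_all add: r1)
      finally show "(\<integral>\<^sup>+y. ennreal (q (y, s)) \<partial>lborel_pow n) = ennreal (mix \<sigma> n Ma b s)" .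
    qed
    also have "\<dots> = ennreal 1" using integral_mix[OF assms(1,2)] by simp
    finally show "integrable ?L q" "(\<integral>z. q z \<partial>?L) = 1"
      using nn_integral_eq_integrable[of q ?L 1, OF qm AE_I2[OF less_imp_le[OF q_pos]]] by simp_all
  qed

  obtain d e where "\<And>y. \<bar>ln (R y)\<bar> \<le> d + e * y\<^sup>2" using output_kernelD(5)[OF K] by blast
  note intR = integrable_normal_ln[OF assms(1) output_kernelD(1)[OF K] this]
  have res: "distributed (P ma mb) lborel (\<lambda>z. k * (fst z t - c * snd z t))
      (normal_density (k * hc * xb mb t) \<sigma>)" if "t < n" for ma mb t
  proof -
    have "k * (a ma mb t - c * b ma t) = k * hc * xb mb t"
      using assms by (simp add: a_def b_def c_def)
    then show ?thesis
      unfolding P_def using genie_residual_normal[OF assms(1) c that k k1, of "a ma mb" "b ma"]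
      by presburger
  qed
  have resI: "integrable (P ma mb) (\<lambda>z. ln (R (k * (fst z t - c * snd z t))))"
    "(\<integral>z. ln (R (k * (fst z t - c * snd z t))) \<partial>P ma mb)
      = (\<integral>y. normal_density (k * hc * xb mb t) \<sigma> y * ln (R y) \<partial>lborel)" if "t < n" for ma mb t
    using distributed_integrable[OF res[OF that], of "\<lambda>y. ln (R y)"]
      distributed_integral[OF res[OF that], of "\<lambda>y. ln (R y)"] intR by auto
  have ln_r: "ln (r z) = (\<Sum>t<n. ln k + ln (R (k * (fst z t - c * snd z t))))" for z
  proof -
    have "ln (r z) = (\<Sum>t<n. ln (k * R (k * (fst z t - c * snd z t))))"
      unfolding r_def using k output_kernelD(2)[OF K] by (intro ln_prod) (auto simp: less_le)
    moreover have "R y \<noteq> 0" for y using output_kernelD(2)[OF K, of y] by simp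
    ultimately show ?thesis using k by (simp add: ln_mult)
  qed
  have ln_r_int: "integrable (P ma mb) (\<lambda>z. ln (r z))" for ma mb
  proof -
    interpret prob_space "P ma mb" by (rule prob)
    show ?thesis unfolding ln_r using resI(1)
      by (intro Bochner_Integration.integrable_sum Bochner_Integration.integrable_add) auto
  qed
  have ln_r_val: "(\<integral>z. ln (r z) \<partial>P ma mb)
    = real n * ln k - (\<Sum>t<n. \<integral>y. normal_density (k * hc * xb mb t) \<sigma> y * (- ln (R y)) \<partial>lborel)" for ma mb
  proof -
    interpret prob_space "P ma mb" by (rule prob)
    have "(\<integral>z. ln (r z) \<partial>P ma mb)
      = (\<Sum>t<n. \<integral>z. ln k + ln (R (k * (fst z t - c * snd z t))) \<partial>P ma mb)"
      unfolding ln_r using resI(1)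
      by (intro Bochner_Integration.integral_sum Bochner_Integration.integrable_add) auto
    also have "\<dots> = (\<Sum>t<n. ln k + (\<integral>y. normal_density (k * hc * xb mb t) \<sigma> y * ln (R y) \<partial>lborel))"
      using resI by (intro sum.cong refl) (simp add: prob_space)
    finally show ?thesis by (simp add: sum.distrib sum_negf)
  qed

  define F where "F = (\<lambda>ma z. ln (mix \<sigma> n Mb (a ma) (fst z)) + ln (gauss \<sigma> n (b ma) (snd z))
      - ln (mix \<sigma> n Ma b (snd z)) - ln (r z))"
  have F: "ln (p ma z) - ln (q z) = F ma z" for ma z
  proof -
    have "mix \<sigma> n Mb (a ma) (fst z) \<noteq> 0" "gauss \<sigma> n (b ma) (snd z) \<noteq> 0"
      "mix \<sigma> n Ma b (snd z) \<noteq> 0" "r z \<noteq> 0"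
      using mix_pos[OF assms(1,3), of n "a ma" "fst z"] gauss_pos[OF assms(1), of n "b ma" "snd z"]
        mix_pos[OF assms(1,2), of n b "snd z"] r_pos[of z] by auto
    then show ?thesis unfolding p_def q_def F_def by (simp add: ln_mult)
  qed
  have Fm[measurable]: "F ma \<in> borel_measurable ?L" for ma unfolding F_def by measurable
  have F1: "integrable (P ma mb) (\<lambda>z. ln (mix \<sigma> n Mb (a ma) (fst z)))"
    "integrable (P ma mb) (\<lambda>z. ln (gauss \<sigma> n (b ma) (snd z)))"
    "integrable (P ma mb) (\<lambda>z. ln (mix \<sigma> n Ma b (snd z)))" for ma mb
    unfolding P_def
    by (rule pair_marginal_integral(2) pair_marginal_integral(4), rule assms(1), measurable,
        rule integrable_ln_mix[OF assms(1,3)] integrable_ln_mix[OF assms(1,2)]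
          integrable_ln_gauss[OF assms(1)])+
  have F_int: "integrable (P ma mb) (F ma)" for ma mb
    unfolding F_def by (intro Bochner_Integration.integrable_diff Bochner_Integration.integrable_add F1 ln_r_int)
  \<comment> \<open>Up to sign and averaging over messages, H and G are the entropies of the other
    user's and of the own genie signal. T is the cross entropy of the rescaled residual against
    R.\<close>
  define H where "H = (\<lambda>mb. \<integral>y. ln (mix \<sigma> n Mb (\<lambda>m t. hc * xb m t) y) \<partial>out_dist \<sigma> n (\<lambda>t. hc * xb mb t))"
  define G where "G = (\<lambda>ma. \<integral>y. ln (mix \<sigma> n Ma b y) \<partial>out_dist \<sigma> n (b ma))"
  define T where "T = (\<lambda>mb. \<Sum>t<n. \<integral>y. normal_density (k * hc * xb mb t) \<sigma> y * (- ln (R y)) \<partial>lborel)"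
  have F_val: "(\<integral>z. F ma z \<partial>P ma mb) = H mb - real n * ?c0 - G ma - real n * ln k + T mb" for ma mb
  proof -
    have "(\<integral>z. F ma z \<partial>P ma mb) = (\<integral>z. ln (mix \<sigma> n Mb (a ma) (fst z)) \<partial>P ma mb)
      + (\<integral>z. ln (gauss \<sigma> n (b ma) (snd z)) \<partial>P ma mb)
      - (\<integral>z. ln (mix \<sigma> n Ma b (snd z)) \<partial>P ma mb) - (\<integral>z. ln (r z) \<partial>P ma mb)"
      unfolding F_def using F1 ln_r_int by simp
    moreover have "(\<integral>z. ln (mix \<sigma> n Mb (a ma) (fst z)) \<partial>P ma mb) = H mb"
    proof -
      have "(\<integral>z. ln (mix \<sigma> n Mb (a ma) (fst z)) \<partial>P ma mb)
        = (\<integral>y. ln (mix \<sigma> n Mb (a ma) y) \<partial>out_dist \<sigma> n (a ma mb))"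
        unfolding P_def by (rule pair_marginal_integral(1)[OF assms(1)]) measurable
      also have "\<dots> = H mb"
        unfolding H_def a_def
        using integral_ln_mix_shift[OF assms(1,3), where n = n and c = "\<lambda>m t. hc * xb m t"
            and d = "\<lambda>t. hs * xa ma t" and a = "\<lambda>t. hc * xb mb t"]
        by (simp add: add.commute)
      finally show ?thesis .
    qed
    moreover have "(\<integral>z. ln (gauss \<sigma> n (b ma) (snd z)) \<partial>P ma mb) = - real n * ?c0"
      unfolding P_def
      by (subst pair_marginal_integral(3)[OF assms(1)]) (measurable, rule integral_ln_gauss[OF assms(1)])
    moreover have "(\<integral>z. ln (mix \<sigma> n Ma b (snd z)) \<partial>P ma mb) = G ma"
      unfolding P_def G_def by (rule pair_marginal_integral(3)[OF assms(1)]) measurable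
    ultimately show ?thesis unfolding ln_r_val T_def by simp
  qed

  let ?D = "\<lambda>m. {y \<in> space (lborel_pow n). g y = m}"
  let ?E = "\<lambda>m. {z \<in> space ?L. g (fst z) = m}"
  have gm[measurable]: "?D m \<in> sets (lborel_pow n)" for m
    by (rule indicator_integral_out_dist(1)[OF assms(1) g])
  \<comment> \<open>The decoder ignores the genie signal, so its decision sets are
    cylinders.\<close>
  have E: "?E m = ?D m \<times> space (lborel_pow n)" for m by (auto simp: space_pair_measure)
  have Em[measurable]: "?E m \<in> sets ?L" for m
    unfolding E by (intro pair_measureI gm sets.top)
  have mixint: "integrable ?L (\<lambda>z. p ma z * f z)"
    "(\<integral>z. p ma z * f z \<partial>?L) = (\<Sum>mb\<in>{1..Mb}. \<integral>z. f z \<partial>P ma mb) / Mb"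
    if "f \<in> borel_measurable ?L" "\<And>mb. integrable (P ma mb) f" for ma and f :: "_ \<Rightarrow> real"
    unfolding p_def P_def
    by (rule mix_gauss_integral[OF assms(1) that(1)] that(2)[unfolded P_def])+
  have "ln Ma * (\<Sum>m\<in>{1..Ma}. \<integral>z. indicator (?E m) z * p m z \<partial>?L) - Ma
    \<le> (\<Sum>m\<in>{1..Ma}. \<integral>z. p m z * (ln (p m z) - ln (q z)) \<partial>?L)"
  proof (rule decoder_converse[OF assms(2)])
    fix m
    \<comment> \<open>With the constant 1 as integrand, \<open>mixint\<close> says that p m is a
      probability density.\<close>
    have one: "(\<lambda>_. 1) \<in> borel_measurable ?L" "integrable (P m mb) (\<lambda>_. 1 :: real)"
      "(\<integral>z. 1 \<partial>P m mb) = (1 :: real)" for mb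
    proof -
      interpret prob_space "P m mb" by (rule prob)
      show "integrable (P m mb) (\<lambda>_. 1 :: real)" "(\<integral>z. 1 \<partial>P m mb) = (1 :: real)"
        by (simp_all add: prob_space)
    qed simp
    show "integrable ?L (p m)" "(\<integral>z. p m z \<partial>?L) = 1"
      using mixint[where ma = m, OF one(1,2)] one(3) assms(3) by simp_all
    show "integrable ?L (\<lambda>z. p m z * (ln (p m z) - ln (q z)))"
      unfolding F by (rule mixint(1)[OF Fm F_int])
  qed (use q_int q_pos p_pos Em in auto)
  also have "\<dots> = (\<Sum>ma\<in>{1..Ma}. (\<Sum>mb\<in>{1..Mb}. H mb - real n * ?c0 - G ma - real n * ln k + T mb) / Mb)"
    unfolding F mixint(2)[OF Fm F_int] F_val ..
  also have "\<dots> = (\<Sum>ma\<in>{1..Ma}. (\<Sum>mb\<in>{1..Mb}. H mb) / Mb - real n * ?c0 - G ma - real n * ln k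
      + (\<Sum>mb\<in>{1..Mb}. T mb) / Mb)"
  proof -
    have "(\<Sum>mb\<in>{1..Mb}. f mb - u - v - w + h mb) / Mb
      = (\<Sum>mb\<in>{1..Mb}. f mb) / Mb - u - v - w + (\<Sum>mb\<in>{1..Mb}. h mb) / Mb"
      for f h :: "nat \<Rightarrow> real" and u v w :: real
      using assms(3) by (simp add: sum.distrib sum_subtractf diff_divide_distrib add_divide_distrib)
    then show ?thesis by presburger
  qed
  also have "\<dots> = real Ma * ((\<Sum>mb\<in>{1..Mb}. H mb) / Mb - real n * ?c0 - real n * ln k
      + (\<Sum>mb\<in>{1..Mb}. T mb) / Mb) - (\<Sum>ma\<in>{1..Ma}. G ma)"
  proof -
    have "(\<Sum>ma\<in>{1..Ma}. s - u - f ma - w + t) = real Ma * (s - u - w + t) - (\<Sum>ma\<in>{1..Ma}. f ma)"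
      for f :: "nat \<Rightarrow> real" and s t u w :: real
      by (simp add: sum.distrib sum_subtractf algebra_simps)
    then show ?thesis by presburger
  qed
  also have "\<dots> \<le> real Ma * ((\<Sum>mb\<in>{1..Mb}. H mb) / Mb - real n * ?c0 - real n * ln k
      + real n * (?c0 + C)) - (\<Sum>ma\<in>{1..Ma}. G ma)"
  proof -
    have "(\<Sum>mb\<in>{1..Mb}. T mb) \<le> real Mb * (real n * (?c0 + C))"
      unfolding T_def by (rule output_kernel_codebook[OF K], rule x)
    then have "(\<Sum>mb\<in>{1..Mb}. T mb) / Mb \<le> real n * (?c0 + C)"
      using assms(3) by (simp add: pos_divide_le_eq mult.commute)
    then show ?thesis by (intro diff_right_mono mult_left_mono add_left_mono) auto
  qed
  also have "\<dots> = real Ma * ((\<Sum>mb\<in>{1..Mb}. H mb) / Mb - (\<Sum>ma\<in>{1..Ma}. G ma) / Ma + real n * (C - ln k))"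
  proof -
    have "real Ma * (s - real n * c - real n * l + real n * (c + C)) - d = real Ma * (s - d / Ma + real n * (C - l))"
      for s c l d :: real
      using assms(2) by (simp add: right_diff_distrib distrib_left)
    then show ?thesis by presburger
  qed
  finally have main: "ln Ma * (\<Sum>m\<in>{1..Ma}. \<integral>z. indicator (?E m) z * p m z \<partial>?L) - Ma
    \<le> real Ma * ((\<Sum>mb\<in>{1..Mb}. H mb) / Mb - (\<Sum>ma\<in>{1..Ma}. G ma) / Ma + real n * (C - ln k))" .
  have success: "(\<integral>z. indicator (?E m) z * p m z \<partial>?L)
    = (\<Sum>mb\<in>{1..Mb}. 1 - measure (N m mb) {y \<in> space (N m mb). g y \<noteq> m}) / Mb" for m
  proof -
    have "(\<integral>z. indicator (?E m) z * p m z \<partial>?L) = (\<integral>z. p m z * indicator (?D m) (fst z) \<partial>?L)"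
      by (rule Bochner_Integration.integral_cong) (auto simp: space_pair_measure split: split_indicator)
    also have "\<dots> = (\<Sum>mb\<in>{1..Mb}. \<integral>z. indicator (?D m) (fst z) \<partial>P m mb) / Mb"
    proof (rule mixint(2))
      show "(\<lambda>z. indicator (?D m) (fst z) :: real) \<in> borel_measurable ?L" by measurable
      fix mb
      interpret o: prob_space "out_dist \<sigma> n (a m mb)" by (rule prob_space_out_dist[OF assms(1)])
      have "integrable (out_dist \<sigma> n (a m mb)) (indicator (?D m) :: _ \<Rightarrow> real)"
        using gm by (intro integrable_real_indicator) (auto simp: o.emeasure_eq_measure)
      then show "integrable (P m mb) (\<lambda>z. indicator (?D m) (fst z) :: real)"
        unfolding P_def by (rule pair_marginal_integral(2)[OF assms(1), rotated]) measurable
    qed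
    also have "\<dots> = (\<Sum>mb\<in>{1..Mb}. 1 - measure (N m mb) {y \<in> space (N m mb). g y \<noteq> m}) / Mb"
    proof -
      have "(\<integral>z. indicator (?D m) (fst z) \<partial>P m mb) = 1 - measure (N m mb) {y \<in> space (N m mb). g y \<noteq> m}" for mb
      proof -
        have "N m mb = out_dist \<sigma> n (a m mb)" by (simp add: N_def a_def)
        moreover have "(\<integral>z. indicator (?D m) (fst z) \<partial>P m mb)
          = (\<integral>y. indicator (?D m) y \<partial>out_dist \<sigma> n (a m mb) :: real)"
          unfolding P_def by (rule pair_marginal_integral(1)[OF assms(1)]) measurable
        ultimately show ?thesis
          using indicator_integral_out_dist(2)[OF assms(1) g, where m = m and a = "a m mb"] by presburger
      qed
      then show ?thesis by presburger
    qed
    finally show ?thesis .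
  qed
  have "(\<Sum>mb\<in>{1..Mb}. H mb) / Mb = - output_entropy \<sigma> n Mb (\<lambda>m t. hc * xb m t)"
    by (simp add: output_entropy_def H_def)
  moreover have "(\<Sum>ma\<in>{1..Ma}. G ma) / Ma = - output_entropy \<sigma> n Ma (\<lambda>m t. hx * xa m t)"
    by (simp add: output_entropy_def G_def b_def)
  ultimately show ?thesis using main unfolding success by simp
qed

section \<open>The outer bound\<close>

lemma valid_codeword_scale:
  assumes "valid_codeword A \<alpha> n x" "h > 0"
  shows "valid_codeword (h * A) \<alpha> n (\<lambda>t. h * x t)"
proof -
  have "(\<Sum>t<n. h * x t) = h * (\<Sum>t<n. x t)" by (simp add: sum_distrib_left)
  also have "\<dots> \<le> h * (real n * (\<alpha> * A))"
    using assms by (intro mult_left_mono) (auto simp: valid_codeword_def)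
  finally show ?thesis using assms by (auto simp: valid_codeword_def algebra_simps)
qed

lemma success_eq_err1:
  assumes "Ma > 0" "Mb > 0"
  shows "(\<Sum>ma\<in>{1..Ma}. \<Sum>mb\<in>{1..Mb}. 1 - measure (out_dist \<sigma> n (\<lambda>t. hs * fa ma t + hc * fb mb t))
      {y \<in> space (out_dist \<sigma> n (\<lambda>t. hs * fa ma t + hc * fb mb t)). g y \<noteq> ma})
    = real Ma * real Mb * (1 - err1 \<sigma> hs hc n Ma Mb fa fb g)"
  using assms by (simp add: err1_def Let_def sum_subtractf right_diff_distrib)

text \<open>Exchanging the two sums lets every bound for receiver 1 serve receiver 2 with the users
  swapped.\<close>

lemma err2_eq_err1: "err2 \<sigma> hs hc n Ma Mb fa fb g = err1 \<sigma> hs hc n Mb Ma fb fa g"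
  unfolding err1_def err2_def Let_def by (subst sum.swap) (simp add: mult.commute)

text \<open>Average of \<open>single_user_converse\<close> over the interfering message. The same
  decoder is used for each of them, so the conditional success probabilities average to 1 -
  \<open>err1\<close>.\<close>

lemma single_user_fano:
  assumes "\<sigma> > 0" "hs > 0" "Ma > 0" "Mb > 0" and K: "output_kernel \<sigma> (hs * A) \<alpha> C R"
    and f: "\<And>m. m \<in> {1..Ma} \<Longrightarrow> valid_codeword A \<alpha> n (fa m)"
    and g: "g \<in> PiM {..<n} (\<lambda>_. borel) \<rightarrow>\<^sub>M count_space UNIV"
  shows "(1 - err1 \<sigma> hs hc n Ma Mb fa fb g) * ln Ma \<le> 1 + real n * C"
proof -
  define s where "s = (\<lambda>ma mb. 1 - measure (out_dist \<sigma> n (\<lambda>t. hs * fa ma t + hc * fb mb t))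
    {y \<in> space (out_dist \<sigma> n (\<lambda>t. hs * fa ma t + hc * fb mb t)). g y \<noteq> ma})"
  have "ln Ma * (\<Sum>ma\<in>{1..Ma}. s ma mb) - Ma \<le> real Ma * (real n * C)" for mb
    unfolding s_def
    by (rule single_user_converse[OF assms(1,3) K, where x = "\<lambda>m t. hs * fa m t"])
       (rule valid_codeword_scale[OF f assms(2)], assumption, rule g)
  then have main: "(\<Sum>mb\<in>{1..Mb}. ln Ma * (\<Sum>ma\<in>{1..Ma}. s ma mb) - Ma) \<le> (\<Sum>mb\<in>{1..Mb}. real Ma * (real n * C))"
    by (intro sum_mono)
  have total: "(\<Sum>mb\<in>{1..Mb}. ln Ma * (\<Sum>ma\<in>{1..Ma}. s ma mb) - Ma)
      = ln Ma * (\<Sum>ma\<in>{1..Ma}. \<Sum>mb\<in>{1..Mb}. s ma mb) - real Mb * real Ma"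
  proof -
    have "(\<Sum>ma\<in>{1..Ma}. \<Sum>mb\<in>{1..Mb}. s ma mb) = (\<Sum>mb\<in>{1..Mb}. \<Sum>ma\<in>{1..Ma}. s ma mb)"
      by (rule sum.swap)
    then show ?thesis by (simp add: sum_subtractf flip: sum_distrib_left)
  qed
  have success: "(\<Sum>ma\<in>{1..Ma}. \<Sum>mb\<in>{1..Mb}. s ma mb)
      = real Ma * real Mb * (1 - err1 \<sigma> hs hc n Ma Mb fa fb g)"
    unfolding s_def by (rule success_eq_err1[OF assms(3,4)])
  have "(real Ma * real Mb) * ((1 - err1 \<sigma> hs hc n Ma Mb fa fb g) * ln Ma)
      \<le> (real Ma * real Mb) * (1 + real n * C)"
    using main[unfolded total success] by (simp add: algebra_simps)
  then show ?thesis using assms(3,4) by (simp del: mult_le_cancel_left add: mult_le_cancel_left_pos)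
qed

text \<open>The peak k * hc * A is that of the interfering signal after the residual has been
  rescaled.\<close>

lemma genie_fano:
  assumes "\<sigma> > 0" "hs > 0" "hx > 0" "hc > 0" "Ma > 0" "Mb > 0"
  defines "k \<equiv> hx / sqrt (hs\<^sup>2 + hx\<^sup>2)"
  assumes K: "output_kernel \<sigma> (k * hc * A) \<alpha> C R"
    and f: "\<And>m. m \<in> {1..Mb} \<Longrightarrow> valid_codeword A \<alpha> n (fb m)"
    and g: "g \<in> PiM {..<n} (\<lambda>_. borel) \<rightarrow>\<^sub>M count_space UNIV"
  shows "(1 - err1 \<sigma> hs hc n Ma Mb fa fb g) * ln Ma
    \<le> 1 + output_entropy \<sigma> n Ma (\<lambda>m t. hx * fa m t) - output_entropy \<sigma> n Mb (\<lambda>m t. hc * fb m t)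
      + real n * (C - ln k)"
proof -
  define s where "s = (\<lambda>ma mb. 1 - measure (out_dist \<sigma> n (\<lambda>t. hs * fa ma t + hc * fb mb t))
    {y \<in> space (out_dist \<sigma> n (\<lambda>t. hs * fa ma t + hc * fb mb t)). g y \<noteq> ma})"
  have "0 < hs\<^sup>2 + hx\<^sup>2" using assms by (simp add: add_pos_pos)
  then have khc: "k * hc > 0" using assms by (simp add: k_def)
  define D where "D = output_entropy \<sigma> n Ma (\<lambda>m t. hx * fa m t) - output_entropy \<sigma> n Mb (\<lambda>m t. hc * fb m t)
      + real n * (C - ln k)"
  have main: "ln Ma * (\<Sum>ma\<in>{1..Ma}. (\<Sum>mb\<in>{1..Mb}. s ma mb) / Mb) - Ma \<le> real Ma * D"
    unfolding s_def D_def k_def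
    by (rule genie_converse[OF assms(1,5,6,2,3) K[unfolded k_def]])
       (rule valid_codeword_scale[OF f khc, unfolded k_def], assumption, rule g)
  have success: "(\<Sum>ma\<in>{1..Ma}. (\<Sum>mb\<in>{1..Mb}. s ma mb) / Mb)
      = real Ma * (1 - err1 \<sigma> hs hc n Ma Mb fa fb g)"
    unfolding sum_divide_distrib[symmetric] s_def success_eq_err1[OF assms(5,6)]
    using assms(6) by simp
  have "real Ma * ((1 - err1 \<sigma> hs hc n Ma Mb fa fb g) * ln Ma) \<le> real Ma * (1 + D)"
    using main[unfolded success] by (simp add: algebra_simps)
  then have "(1 - err1 \<sigma> hs hc n Ma Mb fa fb g) * ln Ma \<le> 1 + D" using assms(5) by simp
  then show ?thesis by (simp add: D_def)
qed

section \<open>From error probabilities to rates\<close>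

lemma num_msgs_pos: "num_msgs n R > 0"
  by (simp add: num_msgs_def)

lemma ln_num_msgs_ge: "real n * R * ln 2 \<le> ln (num_msgs n R)"
proof -
  have "2 powr (real n * R) \<le> real (num_msgs n R)"
    unfolding num_msgs_def by linarith
  then have "ln (2 powr (real n * R)) \<le> ln (real (num_msgs n R))"
    using num_msgs_pos[of n R] by (subst ln_le_cancel_iff) auto
  then show ?thesis by (simp add: ln_powr)
qed

text \<open>The 2 collects the additive constant 1 of two converses and vanishes after division by
  n. A single user is covered by R2 = 0 and e2 = 0.\<close>

lemma rate_limit:
  fixes e1 e2 :: "nat \<Rightarrow> real"
  assumes e: "e1 \<longlonglongrightarrow> 0" "e2 \<longlonglongrightarrow> 0"
    and le: "\<And>n. (1 - e1 n) * ln (num_msgs n R1) + (1 - e2 n) * ln (num_msgs n R2) \<le> 2 + real n * D"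
  shows "(R1 + R2) * ln 2 \<le> D"
proof (rule tendsto_le[of sequentially "\<lambda>n. 2 / real n + D" D
      "\<lambda>n. ((1 - e1 n) * R1 + (1 - e2 n) * R2) * ln 2"])
  have "(\<lambda>n. 2 / real n) \<longlonglongrightarrow> 0" by real_asymp
  then show "(\<lambda>n. 2 / real n + D) \<longlonglongrightarrow> D" using tendsto_add[OF _ tendsto_const, of _ 0] by fastforce
  have "(\<lambda>n. ((1 - e1 n) * R1 + (1 - e2 n) * R2) * ln 2) \<longlonglongrightarrow> ((1 - 0) * R1 + (1 - 0) * R2) * ln 2"
    by (intro tendsto_intros e)
  then show "(\<lambda>n. ((1 - e1 n) * R1 + (1 - e2 n) * R2) * ln 2) \<longlonglongrightarrow> (R1 + R2) * ln 2" by simp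
  have "\<forall>\<^sub>F n in sequentially. e1 n < 1" "\<forall>\<^sub>F n in sequentially. e2 n < 1"
    using e by (auto intro: order_tendstoD)
  then show "\<forall>\<^sub>F n in sequentially. ((1 - e1 n) * R1 + (1 - e2 n) * R2) * ln 2 \<le> 2 / real n + D"
    using eventually_gt_at_top[of 0]
  proof eventually_elim
    case (elim n)
    \<comment> \<open>The factors 1 - e1 n and 1 - e2 n are known to be positive only for large n,
      so the comparison is made eventually.\<close>
    have "(1 - e1 n) * (real n * R1 * ln 2) + (1 - e2 n) * (real n * R2 * ln 2)
      \<le> (1 - e1 n) * ln (num_msgs n R1) + (1 - e2 n) * ln (num_msgs n R2)"
      using elim by (intro add_mono mult_left_mono ln_num_msgs_ge) auto
    also have "\<dots> \<le> 2 + real n * D" by (rule le)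
    finally have "real n * (((1 - e1 n) * R1 + (1 - e2 n) * R2) * ln 2) \<le> real n * (2 / real n + D)"
      using elim by (simp add: algebra_simps)
    then show ?case using elim by simp
  qed
qed simp

text \<open>The price of rescaling the residual, expressed in bits: the square of the scale is 1 /
  (1 + hs^2 / hx^2).\<close>

lemma minus_ln_genie_scale:
  fixes hs hx :: real
  assumes "hs > 0" "hx > 0"
  shows "- ln (hx / sqrt (hs\<^sup>2 + hx\<^sup>2)) = ln 2 * (1 / 2 * log 2 (1 + hs\<^sup>2 / hx\<^sup>2))"
proof -
  have p: "0 < hs\<^sup>2 + hx\<^sup>2" using assms by (simp add: add_pos_pos)
  have "1 + hs\<^sup>2 / hx\<^sup>2 = (hs\<^sup>2 + hx\<^sup>2) / hx\<^sup>2" using assms by (simp add: add_divide_distrib)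
  then have "ln (1 + hs\<^sup>2 / hx\<^sup>2) = ln (hs\<^sup>2 + hx\<^sup>2) - 2 * ln hx"
    using assms p by (simp add: ln_div ln_realpow)
  moreover have "ln (hx / sqrt (hs\<^sup>2 + hx\<^sup>2)) = ln hx - ln (hs\<^sup>2 + hx\<^sup>2) / 2"
    using assms p by (simp add: ln_div ln_sqrt)
  ultimately show ?thesis by (simp add: log_def)
qed

lemma single_user_bound:
  fixes e :: "nat \<Rightarrow> real"
  assumes "\<sigma> > 0" "A > 0" "0 < \<alpha>" "\<alpha> \<le> 1" "hs > 0"
    and "\<And>n. \<forall>m\<in>{1..num_msgs n R}. valid_codeword A \<alpha> n (Fa n m)"
    and "\<And>n. G n \<in> PiM {..<n} (\<lambda>_. borel) \<rightarrow>\<^sub>M count_space UNIV"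
    and e: "(\<lambda>n. err1 \<sigma> hs hc n (num_msgs n R) (num_msgs n R') (Fa n) (Fb n) (G n)) \<longlonglongrightarrow> 0"
  shows "R \<le> Cbar \<sigma> (hs * A) \<alpha>"
proof (rule field_le_epsilon)
  fix d :: real assume "d > 0"
  then obtain K where K: "output_kernel \<sigma> (hs * A) \<alpha> (ln 2 * (Cbar \<sigma> (hs * A) \<alpha> + d)) K"
    using output_kernel_exists[of \<sigma> "hs * A" \<alpha> d] assms by auto
  have "(R + 0) * ln 2 \<le> ln 2 * (Cbar \<sigma> (hs * A) \<alpha> + d)"
  proof (rule rate_limit[OF e tendsto_const])
    fix n
    \<comment> \<open>The second user is a dummy of rate 0 with a single message, whose logarithm
      vanishes.\<close>
    have "num_msgs n 0 = 1" by (simp add: num_msgs_def)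
    moreover have "(1 - err1 \<sigma> hs hc n (num_msgs n R) (num_msgs n R') (Fa n) (Fb n) (G n)) * ln (num_msgs n R)
      \<le> 1 + real n * (ln 2 * (Cbar \<sigma> (hs * A) \<alpha> + d))"
      by (rule single_user_fano[OF assms(1,5) num_msgs_pos num_msgs_pos K]) (use assms(6,7) in auto)
    ultimately show "(1 - err1 \<sigma> hs hc n (num_msgs n R) (num_msgs n R') (Fa n) (Fb n) (G n)) * ln (num_msgs n R)
       + (1 - 0) * ln (num_msgs n 0) \<le> 2 + real n * (ln 2 * (Cbar \<sigma> (hs * A) \<alpha> + d))"
      by simp
  qed
  then show "R \<le> Cbar \<sigma> (hs * A) \<alpha> + d" by (simp add: mult.commute)
qed

lemma achievable_in_outer_bound:
  assumes "\<sigma> > 0" "A > 0" "0 < \<alpha>1" "\<alpha>1 \<le> 1" "0 < \<alpha>2" "\<alpha>2 \<le> 1"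
    and "h11 > 0" "h12 > 0" "h21 > 0" "h22 > 0"
    and ach: "achievable \<sigma> A \<alpha>1 \<alpha>2 h11 h12 h21 h22 (R1, R2)"
  shows "(R1, R2) \<in> outer_bound_ge \<sigma> A \<alpha>1 \<alpha>2 h11 h12 h21 h22"
proof -
  obtain F1 F2 G1 G2 where
    code: "\<And>n. is_code A \<alpha>1 \<alpha>2 n (num_msgs n R1) (num_msgs n R2) (F1 n) (F2 n) (G1 n) (G2 n)"
    and e1: "(\<lambda>n. err1 \<sigma> h11 h21 n (num_msgs n R1) (num_msgs n R2) (F1 n) (F2 n) (G1 n)) \<longlonglongrightarrow> 0"
    and e2: "(\<lambda>n. err1 \<sigma> h22 h12 n (num_msgs n R2) (num_msgs n R1) (F2 n) (F1 n) (G2 n)) \<longlonglongrightarrow> 0"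
    using ach unfolding achievable_def err2_eq_err1 by auto
  have v1: "\<And>n. \<forall>m\<in>{1..num_msgs n R1}. valid_codeword A \<alpha>1 n (F1 n m)"
    and v2: "\<And>n. \<forall>m\<in>{1..num_msgs n R2}. valid_codeword A \<alpha>2 n (F2 n m)"
    and g1: "\<And>n. G1 n \<in> PiM {..<n} (\<lambda>_. borel) \<rightarrow>\<^sub>M count_space UNIV"
    and g2: "\<And>n. G2 n \<in> PiM {..<n} (\<lambda>_. borel) \<rightarrow>\<^sub>M count_space UNIV"
    using code unfolding is_code_def by blast+
  let ?k1 = "h12 / sqrt (h11\<^sup>2 + h12\<^sup>2)" and ?k2 = "h21 / sqrt (h22\<^sup>2 + h21\<^sup>2)"
  let ?C1 = "Cbar \<sigma> (?k1 * h21 * A) \<alpha>2" and ?C2 = "Cbar \<sigma> (?k2 * h12 * A) \<alpha>1"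
  let ?L1 = "1 / 2 * log 2 (1 + h11\<^sup>2 / h12\<^sup>2)" and ?L2 = "1 / 2 * log 2 (1 + h22\<^sup>2 / h21\<^sup>2)"
  have pos: "0 < ?k1 * h21 * A" "0 < ?k2 * h12 * A"
    using assms by (simp_all add: add_pos_pos)
  have "R1 + R2 \<le> (?C1 + ?L1) + (?C2 + ?L2)"
  proof (rule field_le_epsilon)
    fix d :: real assume "d > 0"
    \<comment> \<open>Half of the slack goes to each of the two kernels.\<close>
    then have d: "d / 2 > 0" by simp
    obtain K1 where K1: "output_kernel \<sigma> (?k1 * h21 * A) \<alpha>2 (ln 2 * (?C1 + d / 2)) K1"
      using output_kernel_exists[OF assms(1) pos(1) assms(5,6) d] by blast
    obtain K2 where K2: "output_kernel \<sigma> (?k2 * h12 * A) \<alpha>1 (ln 2 * (?C2 + d / 2)) K2"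
      using output_kernel_exists[OF assms(1) pos(2) assms(3,4) d] by blast
    have "(R1 + R2) * ln 2 \<le> (ln 2 * (?C1 + d / 2) - ln ?k1) + (ln 2 * (?C2 + d / 2) - ln ?k2)"
    proof (rule rate_limit[OF e1 e2])
      fix n
      let ?M1 = "num_msgs n R1" and ?M2 = "num_msgs n R2"
      let ?H1 = "output_entropy \<sigma> n ?M1 (\<lambda>m t. h12 * F1 n m t)"
        and ?H2 = "output_entropy \<sigma> n ?M2 (\<lambda>m t. h21 * F2 n m t)"
      have "(1 - err1 \<sigma> h11 h21 n ?M1 ?M2 (F1 n) (F2 n) (G1 n)) * ln ?M1
        \<le> 1 + ?H1 - ?H2 + real n * (ln 2 * (?C1 + d / 2) - ln ?k1)"
        by (rule genie_fano[OF assms(1,7,8,9) num_msgs_pos num_msgs_pos K1 bspec[OF v2] g1])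
      \<comment> \<open>The same bound with the users exchanged, so ?H1 and ?H2 change sign and drop
        out of the sum.\<close>
      moreover have "(1 - err1 \<sigma> h22 h12 n ?M2 ?M1 (F2 n) (F1 n) (G2 n)) * ln ?M2
        \<le> 1 + ?H2 - ?H1 + real n * (ln 2 * (?C2 + d / 2) - ln ?k2)"
        by (rule genie_fano[OF assms(1,10,9,8) num_msgs_pos num_msgs_pos K2 bspec[OF v1] g2])
      ultimately show "(1 - err1 \<sigma> h11 h21 n ?M1 ?M2 (F1 n) (F2 n) (G1 n)) * ln ?M1
        + (1 - err1 \<sigma> h22 h12 n ?M2 ?M1 (F2 n) (F1 n) (G2 n)) * ln ?M2
        \<le> 2 + real n * ((ln 2 * (?C1 + d / 2) - ln ?k1) + (ln 2 * (?C2 + d / 2) - ln ?k2))"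
        unfolding distrib_left by linarith
    qed
    also have "\<dots> = ((?C1 + ?L1) + (?C2 + ?L2) + d) * ln 2"
    proof -
      have "- ln ?k1 = ln 2 * ?L1" "- ln ?k2 = ln 2 * ?L2"
        using assms by (intro minus_ln_genie_scale; simp)+
      moreover have "(ln 2 * (u + d / 2) - x) + (ln 2 * (v + d / 2) - y) = ((u + p) + (v + q) + d) * ln 2"
        if "- x = ln 2 * p" "- y = ln 2 * q" for u v p q x y :: real
        using that by (simp add: algebra_simps)
      ultimately show ?thesis by blast
    qed
    finally show "R1 + R2 \<le> (?C1 + ?L1) + (?C2 + ?L2) + d" by simp
  qed
  moreover have "?k1 * h21 * A = h12 * h21 / sqrt (h11\<^sup>2 + h12\<^sup>2) * A"
    "?k2 * h12 * A = h12 * h21 / sqrt (h22\<^sup>2 + h21\<^sup>2) * A" by simp_all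
  moreover have "R1 \<le> Cbar \<sigma> (h11 * A) \<alpha>1"
    by (rule single_user_bound[OF assms(1-4,7) v1 g1 e1])
  moreover have "R2 \<le> Cbar \<sigma> (h22 * A) \<alpha>2"
    by (rule single_user_bound[OF assms(1,2,5,6,10) v2 g2 e2])
  moreover have "0 \<le> R1" "0 \<le> R2" using ach by (auto simp: achievable_def)
  ultimately show ?thesis unfolding outer_bound_ge_def by (simp add: mult.commute)
qed

text \<open>The defining inequalities are weak and continuous in the rates. Closedness is what
  carries the bound from achievable pairs to their closure.\<close>

lemma closed_outer_bound: "closed (outer_bound_ge \<sigma> A \<alpha>1 \<alpha>2 h11 h12 h21 h22)"
  unfolding outer_bound_ge_def case_prod_beta
  by (intro closed_Collect_conj closed_Collect_le continuous_intros)

theorem theorem4: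
  fixes \<sigma> A \<alpha>1 \<alpha>2 h11 h12 h21 h22 :: real
  assumes "\<sigma> > 0" and "A > 0"
    and "0 < \<alpha>1" and "\<alpha>1 \<le> 1" and "0 < \<alpha>2" and "\<alpha>2 \<le> 1"
    and "h11 > 0" and "h12 > 0" and "h21 > 0" and "h22 > 0"
  shows "capacity_region \<sigma> A \<alpha>1 \<alpha>2 h11 h12 h21 h22
           \<subseteq> outer_bound_ge \<sigma> A \<alpha>1 \<alpha>2 h11 h12 h21 h22"
  unfolding capacity_region_def
  by (rule closure_minimal[OF _ closed_outer_bound])
     (use achievable_in_outer_bound[OF assms] in auto)

end
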